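(* Let $p$ be an odd prime and let $G$ be a finite powerful $p$-group. Let $N$ be a normal subgroup of $G$ with $N\leq G^{p}$. Then $N$ is powerfully nilpotent.
   Context: For a finite group $H$ and a positive integer $n$, $H^{n}=\langle x^{n} : x\in H\rangle$ denotes the subgroup generated by all $n$-th powers of elements of $H$. For $p$ an odd prime, a finite $p$-group $H$ is powerful if $[H,H]\leq H^{p}$. A powerful $p$-group $H$ is powerfully nilpotent if it has an ascending chain of subgroups $\{1\}=H_{0}\leq H_{1}\leq\dots\leq H_{n}=H$ such that $[H_{i},H]\leq H_{i-1}^{p}$ for $i=1,\dots,n$. In particular, being powerfully nilpotent includes being powerful. *)

theory Defs
  imports "HOL-Computational_Algebra.Primes" "HOL-Algebra.Generated_Groups"
begin

text \<open>
  The subgroups \<open>[A, B]\<close> and \<open>A\<^sup>n\<close> are formed inside an ambient group \<open>G\<close>, as is done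
  for \<^const>\<open>derived\<close>. Commutators are \<open>a b a\<^sup>-\<^sup>1 b\<^sup>-\<^sup>1\<close>, as in \<^const>\<open>derived\<close>; for subgroups
  \<open>A\<close> and \<open>B\<close> the convention \<open>a\<^sup>-\<^sup>1 b\<^sup>-\<^sup>1 a b\<close> gives the same set of generators.
\<close>

definition commutator_subgroup :: "('a, 'b) monoid_scheme \<Rightarrow> 'a set \<Rightarrow> 'a set \<Rightarrow> 'a set" where
  "commutator_subgroup G A B =
     generate G {a \<otimes>\<^bsub>G\<^esub> b \<otimes>\<^bsub>G\<^esub> inv\<^bsub>G\<^esub> a \<otimes>\<^bsub>G\<^esub> inv\<^bsub>G\<^esub> b | a b. a \<in> A \<and> b \<in> B}"

lemma commutator_subgroup_self: "commutator_subgroup G A A = derived G A"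
  unfolding commutator_subgroup_def derived_def
  by (rule arg_cong[where f = "generate G"]) blast

definition power_subgroup :: "('a, 'b) monoid_scheme \<Rightarrow> 'a set \<Rightarrow> nat \<Rightarrow> 'a set" where
  "power_subgroup G A n = generate G ((\<lambda>x. x [^]\<^bsub>G\<^esub> n) ` A)"

definition finite_p_group :: "nat \<Rightarrow> ('a, 'b) monoid_scheme \<Rightarrow> bool" where
  "finite_p_group p H \<longleftrightarrow> group H \<and> finite (carrier H) \<and> (\<exists>k. order H = p ^ k)"

text \<open>This is the definition for odd \<open>p\<close>; for \<open>p = 2\<close> one would require \<open>[H, H] \<le> H\<^sup>4\<close>.\<close>

definition powerful :: "nat \<Rightarrow> ('a, 'b) monoid_scheme \<Rightarrow> bool" where
  "powerful p H \<longleftrightarrow> finite_p_group p H \<and>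
     commutator_subgroup H (carrier H) (carrier H) \<subseteq> power_subgroup H (carrier H) p"

definition powerfully_nilpotent :: "nat \<Rightarrow> ('a, 'b) monoid_scheme \<Rightarrow> bool" where
  "powerfully_nilpotent p H \<longleftrightarrow> powerful p H \<and>
     (\<exists>(n::nat) K. K 0 = {\<one>\<^bsub>H\<^esub>} \<and> K n = carrier H \<and>
        (\<forall>i\<le>n. subgroup (K i) H) \<and>
        (\<forall>i\<in>{1..n}. K (i - 1) \<subseteq> K i \<and>
           commutator_subgroup H (K i) (carrier H) \<subseteq> power_subgroup H (K (i - 1)) p))"

end

theory Submission
  imports Defs "HOL-Algebra.Group_Action" "HOL-Algebra.Multiplicative_Group"
begin

text \<open>
Write \<open>G\<^sub>0 = G\<close> and \<open>G\<^sub>i\<^sub>+\<^sub>1 = G\<^sub>i\<^sup>p\<close> for the power series of \<open>G\<close> (called \<open>agemo\<close> below), and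
\<open>N\<^sub>i = N \<inter> G\<^sub>i\<close>. Since \<open>N \<le> G\<^sup>p\<close>, this is a descending chain from \<open>N\<^sub>1 = N\<close> to the trivial group, and
the claim follows from \<open>[N\<^sub>i, N] \<le> N\<^sub>i\<^sub>+\<^sub>1\<^sup>p\<close> (lemma \<open>commutator_normal_Int_agemo\<close>); the case \<open>i = 1\<close> also
shows that \<open>N\<close> is powerful.

Why this should hold: for \<open>x = a\<^sup>p\<close> in \<open>N\<^sub>i\<close>, with \<open>a \<in> G\<^sub>i\<^sub>-\<^sub>1\<close>, and \<open>h \<in> N\<close>, one expects \<open>[h, a\<^sup>p]\<close> to be
\<open>[h, a]\<^sup>p\<close>, and \<open>[h, a]\<close> does lie in \<open>N\<^sub>i\<^sub>+\<^sub>1\<close>. The obstacle is the remaining factors of the collection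
formula, iterated commutators of \<open>h\<close> with several copies of \<open>a\<close>, which need not be \<open>p\<close>-th powers of
elements of \<open>N\<close> for any obvious reason. (In general \<open>[N, G\<^sup>p] \<le> N\<^sup>p\<close> is false: an element of order \<open>p\<close>
in a powerful group need not commute with \<open>G\<^sup>p\<close>.)

They are controlled by the closure \<open>P\<close> of \<open>a\<close> under conjugation by \<open>\<langle>a, G\<^sup>p\<rangle>\<close>. The main point is that
\<open>P\<close> is again powerful (lemma \<open>powerful_conj_closure_adjoin\<close>). Consequently \<open>P\<^sup>p\<close> is generated by conjugates
of \<open>a\<^sup>p \<in> N\<close>, so \<open>[P, P] \<le> N\<close>, and \<open>[P, P, P] \<le> [P, P]\<^sup>p\<close>. Commutators of \<open>h\<close> with at least three copies
of \<open>a\<close> lie in \<open>[P, P, P]\<close>, and as \<open>p \<ge> 3\<close> the shorter ones occur with exponents divisible by \<open>p\<close>.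

That \<open>P\<close> is powerful is proved by the same mechanism one level further up: each commutator \<open>[t, a]\<close> has a
\<open>p\<close>-th root \<open>s\<close>, since all elements of \<open>G\<^sub>i\<^sub>+\<^sub>1\<close> are \<open>p\<close>-th powers of elements of \<open>G\<^sub>i\<close> (lemma \<open>agemo_root\<close>),
and if the closures of these roots are powerful then so is that of \<open>a\<close> (lemma \<open>powerful_normal_closure\<close>).
Under conjugation by \<open>G\<^sup>p\<close> the roots lie deeper in the power series than \<open>a\<close>, because
\<open>[G\<^sub>i, G\<^sup>p] \<le> G\<^sub>i\<^sub>+\<^sub>2\<close>, so descending induction applies; two more steps pass from there to \<open>\<langle>a, G\<^sup>p\<rangle>\<close>.
\<close>

section \<open>Commutators and conjugates\<close>

definition commutator :: "('a, 'b) monoid_scheme \<Rightarrow> 'a \<Rightarrow> 'a \<Rightarrow> 'a" where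
  "commutator G x y = x \<otimes>\<^bsub>G\<^esub> y \<otimes>\<^bsub>G\<^esub> inv\<^bsub>G\<^esub> x \<otimes>\<^bsub>G\<^esub> inv\<^bsub>G\<^esub> y"

lemma (in group) commutator_closed [simp]:
  "\<lbrakk>x \<in> carrier G; y \<in> carrier G\<rbrakk> \<Longrightarrow> commutator G x y \<in> carrier G"
  by (simp add: commutator_def)

lemma (in group) commutator_mult_swap:
  "\<lbrakk>x \<in> carrier G; y \<in> carrier G\<rbrakk> \<Longrightarrow> commutator G x y \<otimes> y \<otimes> x = x \<otimes> y"
  by (simp add: commutator_def m_assoc)

lemma (in group) inv_commutator:
  "\<lbrakk>x \<in> carrier G; y \<in> carrier G\<rbrakk> \<Longrightarrow> inv (commutator G x y) = commutator G y x"
  by (simp add: commutator_def m_assoc inv_mult_group)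

lemma (in group) commutator_self: "x \<in> carrier G \<Longrightarrow> commutator G x x = \<one>"
  by (simp add: commutator_def m_assoc)

lemma (in group) conj_pow:
  assumes "x \<in> carrier G" "g \<in> carrier G"
  shows "(g \<otimes> x \<otimes> inv g) [^] (n::nat) = g \<otimes> x [^] n \<otimes> inv g"
proof (induction n)
  case (Suc n)
  have "inv g \<otimes> (g \<otimes> (x \<otimes> inv g)) = x \<otimes> inv g"
    using assms by (simp flip: m_assoc)
  then show ?case using Suc assms by (simp add: m_assoc)
qed (use assms in simp)

lemma (in group) conj_mult:
  assumes "x \<in> carrier G" "y \<in> carrier G" "g \<in> carrier G"
  shows "g \<otimes> (x \<otimes> y) \<otimes> inv g = (g \<otimes> x \<otimes> inv g) \<otimes> (g \<otimes> y \<otimes> inv g)"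
proof -
  have "inv g \<otimes> (g \<otimes> (y \<otimes> inv g)) = y \<otimes> inv g"
    using assms by (simp flip: m_assoc)
  then show ?thesis using assms by (simp add: m_assoc)
qed

lemma (in group) conj_inv:
  assumes "x \<in> carrier G" "g \<in> carrier G"
  shows "g \<otimes> inv x \<otimes> inv g = inv (g \<otimes> x \<otimes> inv g)"
  using assms by (simp add: inv_mult_group m_assoc)

lemma (in group) conj_commutator:
  assumes "x \<in> carrier G" "y \<in> carrier G" "g \<in> carrier G"
  shows "g \<otimes> commutator G x y \<otimes> inv g = commutator G (g \<otimes> x \<otimes> inv g) (g \<otimes> y \<otimes> inv g)"
  using assms conj_mult[of "x \<otimes> y \<otimes> inv x" "inv y" g] conj_mult[of "x \<otimes> y" "inv x" g] conj_mult[of x y g]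
  by (simp only: commutator_def conj_inv m_closed inv_closed)

lemma (in group) commutator_consistent:
  assumes "subgroup H G" "x \<in> H" "y \<in> H"
  shows "commutator (G\<lparr>carrier := H\<rparr>) x y = commutator G x y"
  using assms by (simp add: commutator_def)

lemma (in group) commutator_in_subgroup:
  assumes "subgroup H G" "x \<in> H" "y \<in> H"
  shows "commutator G x y \<in> H"
  using assms by (simp add: commutator_def subgroup.m_closed subgroup.m_inv_closed)

lemma (in group) subgroup_nat_pow_closed:
  assumes "subgroup H G" "h \<in> H"
  shows "h [^] (n::nat) \<in> H"
  by (induction n) (use assms in \<open>auto intro: subgroup.m_closed subgroup.one_closed\<close>)

lemma (in group) commutator_in_normal:
  assumes "B \<lhd> G" "x \<in> carrier G" "y \<in> B"
  shows "commutator G x y \<in> B" "commutator G y x \<in> B"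
proof -
  interpret normal B G by fact
  have a: "commutator G x y \<in> B" if "x \<in> carrier G" "y \<in> B" for x y
    using that by (simp add: commutator_def inv_op_closed2)
  show "commutator G x y \<in> B" using a assms by simp
  then show "commutator G y x \<in> B"
    using assms inv_commutator[of x y] m_inv_closed mem_carrier by metis
qed

section \<open>Powers of products modulo a normal subgroup\<close>

text \<open>
The case of nilpotency class 2 of Hall's collection process: each of the \<open>n choose 2\<close> moves of
an \<open>s\<close> past a \<open>c\<close> leaves one factor \<open>w = [s, c]\<close>, and these factors can be pulled to the front.
\<close>

lemma (in group) mult_pow_of_central_commutator:
  assumes c: "c \<in> carrier G" and s: "s \<in> carrier G" and w: "w \<in> carrier G"
    and sc: "s \<otimes> c = w \<otimes> c \<otimes> s" and wc: "w \<otimes> c = c \<otimes> w" and ws: "w \<otimes> s = s \<otimes> w"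
  shows "(c \<otimes> s) [^] (n::nat) = w [^] (n choose 2) \<otimes> c [^] n \<otimes> s [^] n"
proof -
  have wcn: "w [^] i \<otimes> c [^] j = c [^] j \<otimes> w [^] i" for i j :: nat
    by (metis c w wc group_commutes_pow nat_pow_closed)
  have wsn: "w [^] i \<otimes> s [^] j = s [^] j \<otimes> w [^] i" for i j :: nat
    by (metis s w ws group_commutes_pow nat_pow_closed)
  have snc: "s [^] n \<otimes> c = w [^] n \<otimes> c \<otimes> s [^] n" for n :: nat
  proof (induction n)
    case (Suc n)
    have "s [^] Suc n \<otimes> c = s [^] n \<otimes> (w \<otimes> c \<otimes> s)"
      using s c by (simp add: m_assoc sc)
    also have "\<dots> = w \<otimes> (s [^] n \<otimes> c) \<otimes> s"
      using s c w wsn[of 1 n] by (simp flip: m_assoc)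
    also have "\<dots> = w [^] Suc n \<otimes> c \<otimes> s [^] Suc n"
      using s c w nat_pow_Suc2[of w n] by (simp add: Suc m_assoc)
    finally show ?case .
  qed (use c in simp)
  show ?thesis
  proof (induction n)
    case (Suc n)
    have ch: "Suc n choose 2 = n + (n choose 2)"
      by (simp add: numeral_2_eq_2)
    have "(c \<otimes> s) [^] Suc n = w [^] (n choose 2) \<otimes> c [^] n \<otimes> (s [^] n \<otimes> c) \<otimes> s"
      using Suc s c w by (simp add: m_assoc)
    also have "\<dots> = w [^] (n choose 2) \<otimes> (c [^] n \<otimes> w [^] n) \<otimes> c \<otimes> (s [^] n \<otimes> s)"
      using s c w by (simp add: snc m_assoc)
    also have "\<dots> = w [^] (n choose 2) \<otimes> w [^] n \<otimes> (c [^] n \<otimes> c) \<otimes> (s [^] n \<otimes> s)"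
      using s c w by (simp add: wcn[symmetric] m_assoc)
    also have "\<dots> = w [^] (Suc n choose 2) \<otimes> c [^] Suc n \<otimes> s [^] Suc n"
      using s c w by (simp add: nat_pow_mult ch add.commute)
    finally show ?case .
  qed (use c s w in \<open>simp add: numeral_2_eq_2\<close>)
qed

context normal
begin

lemma group_hom_Mod: "group_hom G (G Mod H) (\<lambda>x. H #> x)"
  by (simp add: group_hom_def group_hom_axioms_def factorgroup_is_group r_coset_hom_Mod)

lemma coset_eq_one_iff: "x \<in> carrier G \<Longrightarrow> H #> x = \<one>\<^bsub>G Mod H\<^esub> \<longleftrightarrow> x \<in> H"
  by (metis one_FactGroup coset_join1 coset_join2 subset subgroup_axioms)

lemma coset_eq_iff:
  assumes "x \<in> carrier G" "y \<in> carrier G"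
  shows "H #> x = H #> y \<longleftrightarrow> x \<otimes> inv y \<in> H"
proof -
  interpret q: group_hom G "G Mod H" "\<lambda>x. H #> x" by (rule group_hom_Mod)
  have "x \<otimes> inv y \<in> H \<longleftrightarrow> (H #> x) \<otimes>\<^bsub>G Mod H\<^esub> inv\<^bsub>G Mod H\<^esub> (H #> y) = \<one>\<^bsub>G Mod H\<^esub>"
    using assms coset_eq_one_iff[of "x \<otimes> inv y"] by (metis q.hom_inv q.hom_mult inv_closed m_closed)
  also have "\<dots> \<longleftrightarrow> H #> x = H #> y"
    by (metis assms q.H.inv_equality q.H.inv_inv q.H.r_inv q.hom_closed q.H.inv_closed)
  finally show ?thesis by simp
qed

lemma commutator_mem_iff:
  assumes "x \<in> carrier G" "y \<in> carrier G"
  shows "commutator G x y \<in> H \<longleftrightarrow>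
    (H #> x) \<otimes>\<^bsub>G Mod H\<^esub> (H #> y) = (H #> y) \<otimes>\<^bsub>G Mod H\<^esub> (H #> x)"
proof -
  interpret q: group_hom G "G Mod H" "\<lambda>x. H #> x" by (rule group_hom_Mod)
  have "commutator G x y = (x \<otimes> y) \<otimes> inv (y \<otimes> x)"
    using assms by (simp add: commutator_def inv_mult_group m_assoc)
  then show ?thesis
    using assms coset_eq_iff[of "x \<otimes> y" "y \<otimes> x"] q.hom_mult[of x y] q.hom_mult[of y x]
    by simp
qed

lemma commutator_mem_sym:
  "\<lbrakk>x \<in> carrier G; y \<in> carrier G\<rbrakk> \<Longrightarrow> commutator G x y \<in> H \<longleftrightarrow> commutator G y x \<in> H"
  by (auto simp: commutator_mem_iff)

lemma subgroup_centralizer_mod: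
  assumes x: "x \<in> carrier G"
  shows "subgroup {u \<in> carrier G. commutator G x u \<in> H} G"
proof -
  interpret q: group_hom G "G Mod H" "\<lambda>x. H #> x" by (rule group_hom_Mod)
  let ?x = "H #> x"
  show ?thesis
  proof (rule subgroupI)
    show "{u \<in> carrier G. commutator G x u \<in> H} \<noteq> {}"
      using x by (auto simp: commutator_def intro!: exI[of _ \<one>])
  next
    fix u assume "u \<in> {u \<in> carrier G. commutator G x u \<in> H}"
    then have u: "u \<in> carrier G" "?x \<otimes>\<^bsub>G Mod H\<^esub> (H #> u) = (H #> u) \<otimes>\<^bsub>G Mod H\<^esub> ?x"
      using x by (auto simp: commutator_mem_iff)
    have "?x \<otimes>\<^bsub>G Mod H\<^esub> inv\<^bsub>G Mod H\<^esub> (H #> u) = inv\<^bsub>G Mod H\<^esub> (H #> u) \<otimes>\<^bsub>G Mod H\<^esub> ?x"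
      using u(2) q.H.inv_solve_left q.H.inv_solve_right' q.hom_closed[OF u(1)] q.hom_closed[OF x]
      by (metis q.H.inv_closed q.H.m_assoc q.H.m_closed)
    then show "inv u \<in> {u \<in> carrier G. commutator G x u \<in> H}"
      using x u(1) by (simp add: commutator_mem_iff del: mult_FactGroup one_FactGroup)
  next
    fix u v assume "u \<in> {u \<in> carrier G. commutator G x u \<in> H}" "v \<in> {u \<in> carrier G. commutator G x u \<in> H}"
    then have u: "u \<in> carrier G" "?x \<otimes>\<^bsub>G Mod H\<^esub> (H #> u) = (H #> u) \<otimes>\<^bsub>G Mod H\<^esub> ?x"
      and v: "v \<in> carrier G" "?x \<otimes>\<^bsub>G Mod H\<^esub> (H #> v) = (H #> v) \<otimes>\<^bsub>G Mod H\<^esub> ?x"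
      using x by (auto simp: commutator_mem_iff)
    have "?x \<otimes>\<^bsub>G Mod H\<^esub> ((H #> u) \<otimes>\<^bsub>G Mod H\<^esub> (H #> v)) = (H #> u) \<otimes>\<^bsub>G Mod H\<^esub> (H #> v) \<otimes>\<^bsub>G Mod H\<^esub> ?x"
      using u v x q.hom_closed by (metis q.H.m_assoc)
    then show "u \<otimes> v \<in> {u \<in> carrier G. commutator G x u \<in> H}"
      using x u(1) v(1) by (simp add: commutator_mem_iff del: mult_FactGroup one_FactGroup)
  qed auto
qed

text \<open>
Modulo \<open>H\<close> the commutator \<open>w = [s, c]\<close> is central in the subgroup generated by \<open>c\<close> and \<open>s\<close>, and
its exponent \<open>p choose 2\<close> in the collection formula is a multiple of \<open>p\<close> because \<open>p\<close> is odd.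
\<close>

lemma power_mult_mod:
  fixes p :: nat
  assumes c: "c \<in> carrier G" and s: "s \<in> carrier G" and "odd p"
    and wc: "commutator G (commutator G s c) c \<in> H"
    and ws: "commutator G (commutator G s c) s \<in> H"
    and wp: "commutator G s c [^] p \<in> H"
  shows "(c \<otimes> s) [^] p \<otimes> inv (c [^] p \<otimes> s [^] p) \<in> H"
proof -
  interpret q: group_hom G "G Mod H" "\<lambda>x. H #> x" by (rule group_hom_Mod)
  note [simp del] = mult_FactGroup one_FactGroup
  define w where "w = commutator G s c"
  have w: "w \<in> carrier G" using c s by (simp add: w_def)
  have "s \<otimes> c = w \<otimes> c \<otimes> s"
    using c s by (simp add: w_def commutator_mult_swap)
  then have "(H #> s) \<otimes>\<^bsub>G Mod H\<^esub> (H #> c) = (H #> w) \<otimes>\<^bsub>G Mod H\<^esub> (H #> c) \<otimes>\<^bsub>G Mod H\<^esub> (H #> s)"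
    using c s w by (metis q.hom_mult m_closed)
  moreover have "(H #> w) \<otimes>\<^bsub>G Mod H\<^esub> (H #> c) = (H #> c) \<otimes>\<^bsub>G Mod H\<^esub> (H #> w)"
    using wc c w by (simp add: commutator_mem_iff flip: w_def)
  moreover have "(H #> w) \<otimes>\<^bsub>G Mod H\<^esub> (H #> s) = (H #> s) \<otimes>\<^bsub>G Mod H\<^esub> (H #> w)"
    using ws s w by (simp add: commutator_mem_iff flip: w_def)
  ultimately have *: "((H #> c) \<otimes>\<^bsub>G Mod H\<^esub> (H #> s)) [^]\<^bsub>G Mod H\<^esub> p =
      (H #> w) [^]\<^bsub>G Mod H\<^esub> (p choose 2) \<otimes>\<^bsub>G Mod H\<^esub> (H #> c) [^]\<^bsub>G Mod H\<^esub> p \<otimes>\<^bsub>G Mod H\<^esub> (H #> s) [^]\<^bsub>G Mod H\<^esub> p"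
    using c s w by (intro q.H.mult_pow_of_central_commutator) auto
  have "(H #> w) [^]\<^bsub>G Mod H\<^esub> p = \<one>\<^bsub>G Mod H\<^esub>"
    using wp w coset_eq_one_iff[of "w [^] p"] by (simp add: FactGroup_pow flip: w_def)
  moreover have "p choose 2 = p * ((p - 1) div 2)"
    using \<open>odd p\<close> by (simp add: choose_two div_mult_swap)
  ultimately have "(H #> w) [^]\<^bsub>G Mod H\<^esub> (p choose 2) = \<one>\<^bsub>G Mod H\<^esub>"
    using w by (simp flip: q.H.nat_pow_pow)
  with * have "((H #> c) \<otimes>\<^bsub>G Mod H\<^esub> (H #> s)) [^]\<^bsub>G Mod H\<^esub> p =
      (H #> c) [^]\<^bsub>G Mod H\<^esub> p \<otimes>\<^bsub>G Mod H\<^esub> (H #> s) [^]\<^bsub>G Mod H\<^esub> p"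
    using c s by simp
  then have "H #> (c \<otimes> s) [^] p = H #> (c [^] p \<otimes> s [^] p)"
    using c s q.hom_mult[of c s] q.hom_mult[of "c [^] p" "s [^] p"] FactGroup_pow[of _ p]
    by (metis m_closed nat_pow_closed)
  then show ?thesis
    using c s by (intro coset_eq_iff[THEN iffD1]) auto
qed

text \<open>
Since \<open>[a, s\<^sup>p] = (c s)\<^sup>p s\<^sup>-\<^sup>p\<close> with \<open>c = [a, s]\<close>, the previous lemma identifies \<open>[a, s\<^sup>p]\<close> with
\<open>c\<^sup>p\<close> modulo \<open>H\<close>. All statements below that relate a commutator with a \<open>p\<close>-th power to a
\<open>p\<close>-th power of a commutator are reduced to this one by a suitable choice of \<open>H\<close>.
\<close>

lemma commutator_pow_mem:
  fixes p :: nat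
  assumes a: "a \<in> carrier G" and s: "s \<in> carrier G" and "odd p"
    and c: "c = commutator G a s" and w: "w = commutator G s c"
    and cp: "c [^] p \<in> H" and wp: "w [^] p \<in> H"
    and wc: "commutator G w c \<in> H" and ws: "commutator G w s \<in> H"
  shows "commutator G a (s [^] p) \<in> H"
proof -
  have cc: "c \<in> carrier G" using a s c by simp
  have "c \<otimes> s = a \<otimes> s \<otimes> inv a"
    using a s by (simp add: c commutator_def m_assoc)
  then have "(c \<otimes> s) [^] p = a \<otimes> s [^] p \<otimes> inv a"
    using a s by (simp add: conj_pow)
  moreover have "(c \<otimes> s) [^] p \<otimes> inv (c [^] p \<otimes> s [^] p) \<in> H"
    using power_mult_mod[OF cc s \<open>odd p\<close>] wc ws wp by (simp add: w)
  ultimately have "commutator G a (s [^] p) \<otimes> inv (c [^] p) \<in> H"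
    using a s cc by (simp add: commutator_def inv_mult_group m_assoc)
  then have "commutator G a (s [^] p) \<otimes> inv (c [^] p) \<otimes> c [^] p \<in> H"
    using cp by simp
  then show ?thesis using a s cc by (simp add: m_assoc)
qed

end

section \<open>Finite p-groups and nilpotency\<close>

locale odd_p_group = group G for G (structure) +
  fixes p :: nat
  assumes prime_p: "prime p" and odd_p: "odd p" and p_group: "finite_p_group p G"

context odd_p_group
begin

lemma finite_carrier: "finite (carrier G)"
  using p_group by (simp add: finite_p_group_def)

lemma card_subgroup:
  assumes "subgroup T G"
  obtains k where "card T = p ^ k"
proof -
  obtain n where "order G = p ^ n" using p_group by (auto simp: finite_p_group_def)
  moreover have "card T dvd order G" using lagrange[OF assms] by (metis dvd_triv_right)
  ultimately show ?thesis using that prime_p by (auto simp: divides_primepow_nat)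
qed

lemma odd_p_group_subgroup:
  assumes "subgroup T G"
  shows "odd_p_group (G\<lparr>carrier := T\<rparr>) p"
proof -
  interpret T: group "G\<lparr>carrier := T\<rparr>" by (rule subgroup_imp_group[OF assms])
  show ?thesis
    using prime_p odd_p finite_carrier subgroup.subset[OF assms] card_subgroup[OF assms]
    by unfold_locales
       (auto simp: finite_p_group_def order_def intro: finite_subset T.group_axioms)
qed

lemma odd_p_group_Mod:
  assumes "B \<lhd> G"
  shows "odd_p_group (G Mod B) p"
proof -
  interpret B: normal B G by fact
  interpret q: group "G Mod B" by (rule B.factorgroup_is_group)
  obtain n where "order G = p ^ n" using p_group by (auto simp: finite_p_group_def)
  moreover have "order (G Mod B) dvd order G"
    using lagrange[OF B.subgroup_axioms] by (metis order_def FactGroup_def partial_object.select_convs(1) dvd_triv_left)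
  ultimately have "\<exists>k. order (G Mod B) = p ^ k"
    using prime_p by (auto simp: divides_primepow_nat)
  moreover have "finite (carrier (G Mod B))"
    using finite_carrier by (simp add: carrier_FactGroup)
  ultimately show ?thesis
    using prime_p odd_p by unfold_locales (auto simp: finite_p_group_def intro: q.group_axioms)
qed

text \<open>
Count \<open>A\<close> by conjugacy classes: if \<open>\<one>\<close> were the only central element of \<open>A\<close>, then every class
in \<open>A\<close> but \<open>{\<one>}\<close> would have size divisible by \<open>p\<close>, so \<open>card A\<close> would be congruent to 1
modulo \<open>p\<close>.
\<close>

lemma normal_meets_centre:
  assumes A: "A \<lhd> G" and "A \<noteq> {\<one>}"
  obtains z where "z \<in> A" "z \<noteq> \<one>" "\<forall>g\<in>carrier G. g \<otimes> z = z \<otimes> g"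
proof (rule ccontr)
  assume "\<not> thesis"
  with that have no: "\<And>z. z \<in> A \<Longrightarrow> z \<noteq> \<one> \<Longrightarrow> \<exists>g\<in>carrier G. g \<otimes> z \<noteq> z \<otimes> g"
    by blast
  interpret A: normal A G by fact
  define \<phi> where "\<phi> = (\<lambda>g. \<lambda>h\<in>carrier G. g \<otimes> h \<otimes> inv g)"
  interpret act: group_action G "carrier G" \<phi>
    unfolding \<phi>_def by (rule action_by_conjugation)
  define \<O> where "\<O> = {X \<in> orbits G (carrier G) \<phi>. X \<subseteq> A}"
  have orbit: "orbit G \<phi> x = (\<lambda>g. g \<otimes> x \<otimes> inv g) ` carrier G" if "x \<in> carrier G" for x
    using that by (auto simp: orbit_def \<phi>_def)
  have orbit_in: "orbit G \<phi> x \<in> \<O>" if "x \<in> A" for x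
  proof -
    have x: "x \<in> carrier G" by (rule A.mem_carrier[OF that])
    have "orbit G \<phi> x \<subseteq> A"
      unfolding orbit[OF x] using A.inv_op_closed2[OF _ that] by auto
    then show ?thesis using x unfolding \<O>_def orbits_def by auto
  qed
  have self: "x \<in> orbit G \<phi> x" if "x \<in> carrier G" for x
    using act.orbit_refl[OF that] .
  have union: "\<Union> \<O> = A"
  proof
    show "A \<subseteq> \<Union> \<O>" using orbit_in self A.mem_carrier by blast
  qed (auto simp: \<O>_def)
  have disj: "pairwise disjnt \<O>"
    using act.disjoint_union unfolding \<O>_def pairwise_def disjnt_def by blast
  have "finite A" using finite_carrier A.subset by (rule rev_finite_subset)
  then have fin: "finite \<O>" "\<And>X. X \<in> \<O> \<Longrightarrow> finite X"
    using finite_subset[of \<O> "Pow A"] finite_subset[of _ A] by (auto simp: \<O>_def)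
  have one: "{\<one>} \<in> \<O>"
  proof -
    have "orbit G \<phi> \<one> = {\<one>}" unfolding orbit[OF one_closed] by auto
    with orbit_in[OF A.one_closed] show ?thesis by simp
  qed
  obtain n where n: "order G = p ^ n" using p_group by (auto simp: finite_p_group_def)
  have dvd: "p dvd card X" if X: "X \<in> \<O> - {{\<one>}}" for X
  proof -
    obtain x where x: "x \<in> carrier G" "X = orbit G \<phi> x"
      using X by (auto simp: \<O>_def orbits_def)
    have "x \<in> A" using X self[OF x(1)] x(2) by (auto simp: \<O>_def)
    moreover have "x \<noteq> \<one>"
    proof
      assume "x = \<one>"
      then have "X = {\<one>}" unfolding x(2) orbit[OF x(1)] by auto
      with X show False by simp
    qed
    ultimately obtain g where g: "g \<in> carrier G" "g \<otimes> x \<noteq> x \<otimes> g" using no by blast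
    then have "g \<otimes> x \<otimes> inv g \<noteq> x" using x by (metis inv_solve_right m_closed)
    moreover have "g \<otimes> x \<otimes> inv g \<in> X" "x \<in> X" using g x self orbit by auto
    ultimately have "card X \<noteq> 1" by (auto simp: card_1_singleton_iff)
    moreover have "card X dvd p ^ n"
      using act.orbit_stabilizer_theorem[OF x(1)] n x(2) by (metis dvd_triv_left)
    ultimately show ?thesis
      using prime_p by (auto simp: divides_primepow_nat)
  qed
  have "card A = (\<Sum>X\<in>\<O>. card X)"
    using card_Union_disjoint[OF disj fin(2)] union by simp
  also have "\<dots> = 1 + (\<Sum>X\<in>\<O> - {{\<one>}}. card X)"
    using fin one by (simp add: sum.remove)
  finally have cA: "card A = 1 + (\<Sum>X\<in>\<O> - {{\<one>}}. card X)" .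
  moreover have "p dvd (\<Sum>X\<in>\<O> - {{\<one>}}. card X)"
    using dvd by (rule dvd_sum)
  moreover have "p dvd card A"
  proof -
    obtain k where k: "card A = p ^ k" using card_subgroup[OF A.subgroup_axioms] .
    have "card A \<noteq> 1"
      using \<open>A \<noteq> {\<one>}\<close> A.one_closed by (metis card_1_singletonE singletonD)
    with k show ?thesis by (cases k) auto
  qed
  ultimately have "p dvd 1" by (metis dvd_add_left_iff)
  then show False using prime_p by simp
qed

lemma normal_meets_centre_order_p:
  assumes A: "A \<lhd> G" and "A \<noteq> {\<one>}"
  obtains z where "z \<in> A" "z \<noteq> \<one>" "z [^] p = \<one>" "\<forall>g\<in>carrier G. g \<otimes> z = z \<otimes> g"
proof -
  interpret A: normal A G by fact
  obtain z where z: "z \<in> A" "z \<noteq> \<one>" "\<forall>g\<in>carrier G. g \<otimes> z = z \<otimes> g"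
    using normal_meets_centre[OF assms] by blast
  note zc = A.mem_carrier[OF z(1)]
  obtain n where n: "order G = p ^ n" using p_group by (auto simp: finite_p_group_def)
  define m where "m = (LEAST m. z [^] (p ^ m) = \<one>)"
  have "z [^] (p ^ n) = \<one>" using pow_order_eq_1[OF zc] n by simp
  then have m: "z [^] (p ^ m) = \<one>" unfolding m_def by (rule LeastI)
  with z zc have "m \<noteq> 0" by (auto intro: ccontr)
  then obtain l where l: "m = Suc l" using not0_implies_Suc by blast
  show ?thesis
  proof
    show "z [^] (p ^ l) \<in> A" by (rule subgroup_nat_pow_closed[OF A.subgroup_axioms z(1)])
    show "z [^] (p ^ l) \<noteq> \<one>" using not_less_Least[of l "\<lambda>m. z [^] (p ^ m) = \<one>"] l by (simp add: m_def)
    show "(z [^] (p ^ l)) [^] p = \<one>" using m l zc by (simp add: nat_pow_pow mult.commute)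
    show "\<forall>g\<in>carrier G. g \<otimes> z [^] (p ^ l) = z [^] (p ^ l) \<otimes> g"
      using group_commutes_pow[of z] z(3) zc by metis
  qed
qed

text \<open>
Nilpotency in the form in which it is used: to prove \<open>A \<subseteq> B\<close> for normal subgroups, one may work
modulo a normal subgroup \<open>C\<close> over \<open>B\<close> such that the image of \<open>A\<close> is central of exponent \<open>p\<close> (but
nontrivial, which is to be refuted). Take \<open>C\<close> maximal among the normal subgroups that contain
\<open>B\<close> but not \<open>A\<close>. The elements that are central and of order dividing \<open>p\<close> modulo \<open>C\<close> form a normal
subgroup \<open>W\<close>, strictly larger than \<open>C\<close> because \<open>A\<close> meets the centre modulo \<open>C\<close>; by maximality \<open>W\<close>
contains \<open>A\<close>.
\<close>

lemma normal_separation: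
  assumes A: "A \<lhd> G" and B: "B \<lhd> G" and AB: "\<not> A \<subseteq> B"
  obtains C where "C \<lhd> G" "B \<subseteq> C" "\<not> A \<subseteq> C" "\<forall>a\<in>A. a [^] p \<in> C"
    "\<forall>a\<in>A. \<forall>g\<in>carrier G. commutator G a g \<in> C"
proof -
  interpret A: normal A G by fact
  define \<F> where "\<F> = {C. C \<lhd> G \<and> B \<subseteq> C \<and> \<not> A \<subseteq> C}"
  have "finite \<F>"
    using finite_carrier finite_subset[of \<F> "Pow (carrier G)"]
    by (auto simp: \<F>_def dest!: normal_imp_subgroup subgroup.subset)
  moreover have "B \<in> \<F>" using B AB by (simp add: \<F>_def)
  ultimately obtain C where C: "C \<in> \<F>" and max: "\<And>D. D \<in> \<F> \<Longrightarrow> C \<subseteq> D \<Longrightarrow> D = C"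
    using finite_has_maximal2[of \<F> B] by metis
  have CF: "C \<lhd> G" "B \<subseteq> C" "\<not> A \<subseteq> C" using C by (auto simp: \<F>_def)
  interpret C: normal C G by (rule CF(1))
  interpret q: group_hom G "G Mod C" "\<lambda>x. C #> x" by (rule C.group_hom_Mod)
  interpret Q: odd_p_group "G Mod C" p by (rule odd_p_group_Mod[OF CF(1)])
  note [simp del] = mult_FactGroup one_FactGroup
  have nA: "(\<lambda>x. C #> x) ` A \<lhd> G Mod C"
  proof (rule q.H.normal_invI)
    show "subgroup ((#>) C ` A) (G Mod C)"
      by (rule q.subgroup_img_is_subgroup[OF A.subgroup_axioms])
    fix x h assume x: "x \<in> carrier (G Mod C)" and h: "h \<in> (\<lambda>x. C #> x) ` A"
    obtain g where g: "g \<in> carrier G" "x = C #> g" using x by (auto simp: carrier_FactGroup)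
    obtain a where a: "a \<in> A" "h = C #> a" using h by auto
    have "x \<otimes>\<^bsub>G Mod C\<^esub> h \<otimes>\<^bsub>G Mod C\<^esub> inv\<^bsub>G Mod C\<^esub> x = C #> (g \<otimes> a \<otimes> inv g)"
      using g a A.mem_carrier[OF a(1)] by simp
    then show "x \<otimes>\<^bsub>G Mod C\<^esub> h \<otimes>\<^bsub>G Mod C\<^esub> inv\<^bsub>G Mod C\<^esub> x \<in> (\<lambda>x. C #> x) ` A"
      using A.inv_op_closed2[OF g(1) a(1)] by blast
  qed
  have "(\<lambda>x. C #> x) ` A \<noteq> {\<one>\<^bsub>G Mod C\<^esub>}"
  proof -
    obtain a where "a \<in> A" "a \<notin> C" using CF(3) by blast
    then have "C #> a \<noteq> \<one>\<^bsub>G Mod C\<^esub>" by (simp add: C.coset_eq_one_iff A.mem_carrier)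
    with \<open>a \<in> A\<close> show ?thesis by blast
  qed
  then obtain z where z: "z \<in> (\<lambda>x. C #> x) ` A" "z \<noteq> \<one>\<^bsub>G Mod C\<^esub>" "z [^]\<^bsub>G Mod C\<^esub> p = \<one>\<^bsub>G Mod C\<^esub>"
    and zc: "\<forall>g\<in>carrier (G Mod C). g \<otimes>\<^bsub>G Mod C\<^esub> z = z \<otimes>\<^bsub>G Mod C\<^esub> g"
    by (rule Q.normal_meets_centre_order_p[OF nA])
  from z(1) obtain a where a: "a \<in> A" "z = C #> a" by blast
  define W where "W = {x \<in> carrier G. x [^] p \<in> C \<and> (\<forall>g\<in>carrier G. commutator G x g \<in> C)}"
  have W_iff: "x \<in> W \<longleftrightarrow> x \<in> carrier G \<and> (C #> x) [^]\<^bsub>G Mod C\<^esub> p = \<one>\<^bsub>G Mod C\<^esub> \<and>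
      (\<forall>g\<in>carrier G. (C #> x) \<otimes>\<^bsub>G Mod C\<^esub> (C #> g) = (C #> g) \<otimes>\<^bsub>G Mod C\<^esub> (C #> x))" for x
    using C.coset_eq_one_iff[of "x [^] p"]
    by (auto simp: W_def C.FactGroup_pow C.commutator_mem_iff)
  have comm: "commutator G g x \<in> C" if "x \<in> W" "g \<in> carrier G" for x g
    using that C.commutator_mem_sym by (auto simp: W_def)
  have cent: "x \<in> carrier G \<Longrightarrow> (\<And>g. g \<in> carrier G \<Longrightarrow> commutator G g x \<in> C) \<Longrightarrow> x [^] p \<in> C \<Longrightarrow> x \<in> W" for x
    using C.commutator_mem_sym by (auto simp: W_def)
  have W: "subgroup W G"
  proof (rule subgroupI)
    show "W \<subseteq> carrier G" by (auto simp: W_def)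
    have "\<one> \<in> W" by (auto simp: W_def commutator_def)
    then show "W \<noteq> {}" by blast
  next
    fix x assume x: "x \<in> W"
    then have xc: "x \<in> carrier G" by (simp add: W_def)
    show "inv x \<in> W"
    proof (rule cent)
      show "commutator G g (inv x) \<in> C" if "g \<in> carrier G" for g
        using subgroup.m_inv_closed[OF C.subgroup_centralizer_mod[OF that], of x] comm[OF x that] xc by simp
      show "inv x [^] p \<in> C" using x by (simp add: W_def nat_pow_inv)
    qed (use xc in simp)
  next
    fix x y assume x: "x \<in> W" and y: "y \<in> W"
    then have xc: "x \<in> carrier G" "y \<in> carrier G" by (simp_all add: W_def)
    show "x \<otimes> y \<in> W"
    proof (rule cent)
      show "commutator G g (x \<otimes> y) \<in> C" if "g \<in> carrier G" for g
        using subgroup.m_closed[OF C.subgroup_centralizer_mod[OF that], of x y]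
          comm[OF x that] comm[OF y that] xc by simp
      have "(C #> x) \<otimes>\<^bsub>G Mod C\<^esub> (C #> y) = (C #> y) \<otimes>\<^bsub>G Mod C\<^esub> (C #> x)"
        using x xc(2) unfolding W_iff by blast
      then have "(C #> (x \<otimes> y)) [^]\<^bsub>G Mod C\<^esub> p = (C #> x) [^]\<^bsub>G Mod C\<^esub> p \<otimes>\<^bsub>G Mod C\<^esub> (C #> y) [^]\<^bsub>G Mod C\<^esub> p"
        unfolding q.hom_mult[OF xc] by (rule q.H.pow_mult_distrib[OF _ q.hom_closed[OF xc(1)] q.hom_closed[OF xc(2)]])
      also have "\<dots> = \<one>\<^bsub>G Mod C\<^esub>"
        using x y unfolding W_iff by simp
      finally have "C #> (x \<otimes> y) [^] p = \<one>\<^bsub>G Mod C\<^esub>"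
        using xc C.FactGroup_pow[of "x \<otimes> y" p] by simp
      then show "(x \<otimes> y) [^] p \<in> C" using xc C.coset_eq_one_iff[of "(x \<otimes> y) [^] p"] by simp
    qed (use xc in simp)
  qed
  have CW: "C \<subseteq> W"
    using commutator_in_normal(2)[OF CF(1)] subgroup_nat_pow_closed[OF C.subgroup_axioms]
    by (auto simp: W_def)
  have nW: "W \<lhd> G"
  proof (rule normal_invI[OF W])
    fix g x assume g: "g \<in> carrier G" and x: "x \<in> W"
    then have xc: "x \<in> carrier G" by (simp add: W_def)
    have "g \<otimes> x \<otimes> inv g = commutator G g x \<otimes> x"
      using g xc by (simp add: commutator_def m_assoc)
    then show "g \<otimes> x \<otimes> inv g \<in> W"
      using comm[OF x g] CW x subgroup.m_closed[OF W] by auto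
  qed
  have "a \<in> W" "a \<notin> C"
    using a z(2,3) zc A.mem_carrier[OF a(1)] C.coset_eq_one_iff[of a] by (auto simp: W_iff)
  then have "W \<notin> \<F>" using max[of W] CW by blast
  then have AW: "A \<subseteq> W" using nW CW CF(2) by (auto simp: \<F>_def)
  show ?thesis
    by (rule that[OF CF]) (use AW in \<open>auto simp: W_def\<close>)
qed

end

section \<open>Commutator and power subgroups\<close>

context group
begin

lemma carrier_normal: "carrier G \<lhd> G"
  by (rule normal_invI[OF subgroup_self]) auto

lemma commutator_subgroup_eq:
  "commutator_subgroup G A B = generate G {commutator G a b | a b. a \<in> A \<and> b \<in> B}"
  by (simp add: commutator_subgroup_def commutator_def)

lemma commutator_mem: "\<lbrakk>a \<in> A; b \<in> B\<rbrakk> \<Longrightarrow> commutator G a b \<in> commutator_subgroup G A B"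
  unfolding commutator_subgroup_eq by (rule generate.incl) blast

lemma commutator_subgroup_leI:
  assumes "subgroup C G" "\<And>a b. \<lbrakk>a \<in> A; b \<in> B\<rbrakk> \<Longrightarrow> commutator G a b \<in> C"
  shows "commutator_subgroup G A B \<subseteq> C"
  unfolding commutator_subgroup_eq by (rule generate_subgroup_incl) (use assms in auto)

lemma subgroup_commutator_subgroup:
  "\<lbrakk>A \<subseteq> carrier G; B \<subseteq> carrier G\<rbrakk> \<Longrightarrow> subgroup (commutator_subgroup G A B) G"
  unfolding commutator_subgroup_eq by (rule generate_is_subgroup) (blast intro: commutator_closed)

lemma commutator_subgroup_consistent:
  assumes "subgroup H G" "A \<subseteq> H" "B \<subseteq> H"
  shows "commutator_subgroup (G\<lparr>carrier := H\<rparr>) A B = commutator_subgroup G A B"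
proof -
  have "{commutator (G\<lparr>carrier := H\<rparr>) a b | a b. a \<in> A \<and> b \<in> B} = {commutator G a b | a b. a \<in> A \<and> b \<in> B}"
  proof -
    have "commutator (G\<lparr>carrier := H\<rparr>) a b = commutator G a b" if "a \<in> A" "b \<in> B" for a b
      using commutator_consistent[OF assms(1)] that assms(2,3) by auto
    then show ?thesis unfolding set_eq_iff mem_Collect_eq by metis
  qed
  moreover have "{commutator G a b | a b. a \<in> A \<and> b \<in> B} \<subseteq> H"
    using commutator_in_subgroup[OF assms(1)] assms(2,3) by blast
  ultimately show ?thesis
    using generate_consistent[OF _ assms(1)] subgroup_imp_group[OF assms(1)]
    by (simp add: commutator_subgroup_eq group.commutator_subgroup_eq)
qed

lemma normal_commutator_subgroup:
  assumes "A \<lhd> G" "B \<lhd> G"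
  shows "commutator_subgroup G A B \<lhd> G"
  unfolding commutator_subgroup_eq
proof (rule normal_generateI)
  interpret A: normal A G by fact
  interpret B: normal B G by fact
  show "{commutator G a b |a b. a \<in> A \<and> b \<in> B} \<subseteq> carrier G" by auto
  show "g \<otimes> h \<otimes> inv g \<in> {commutator G a b |a b. a \<in> A \<and> b \<in> B}"
    if h: "h \<in> {commutator G a b |a b. a \<in> A \<and> b \<in> B}" and g: "g \<in> carrier G" for h g
  proof -
    obtain a b where ab: "a \<in> A" "b \<in> B" "h = commutator G a b" using h by blast
    then have "g \<otimes> h \<otimes> inv g = commutator G (g \<otimes> a \<otimes> inv g) (g \<otimes> b \<otimes> inv g)"
      using conj_commutator[of a b g] g A.mem_carrier B.mem_carrier by simp
    then show ?thesis
      using A.inv_op_closed2[OF g ab(1)] B.inv_op_closed2[OF g ab(2)] by blast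
  qed
qed

lemma pow_mem: "a \<in> A \<Longrightarrow> a [^] n \<in> power_subgroup G A n"
  unfolding power_subgroup_def by (rule generate.incl) blast

lemma power_subgroup_leI:
  assumes "subgroup C G" "\<And>a. a \<in> A \<Longrightarrow> a [^] n \<in> C"
  shows "power_subgroup G A n \<subseteq> C"
  unfolding power_subgroup_def by (rule generate_subgroup_incl) (use assms in auto)

lemma power_subgroup_mono: "A \<subseteq> B \<Longrightarrow> power_subgroup G A n \<subseteq> power_subgroup G B n"
  unfolding power_subgroup_def by (rule mono_generate) blast

lemma power_subgroup_le: "subgroup A G \<Longrightarrow> power_subgroup G A (n::nat) \<subseteq> A"
  by (intro power_subgroup_leI subgroup_nat_pow_closed)

lemma power_subgroup_consistent:
  assumes "subgroup H G" "A \<subseteq> H"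
  shows "power_subgroup (G\<lparr>carrier := H\<rparr>) A (n::nat) = power_subgroup G A n"
proof -
  have "(\<lambda>x. x [^] n) ` A \<subseteq> H"
    using subgroup_nat_pow_closed[OF assms(1)] assms(2) by blast
  then show ?thesis
    using generate_consistent[OF _ assms(1)] by (simp add: power_subgroup_def nat_pow_consistent[symmetric])
qed

lemma normal_power_subgroup:
  assumes "A \<lhd> G"
  shows "power_subgroup G A (n::nat) \<lhd> G"
  unfolding power_subgroup_def
proof (rule normal_generateI)
  interpret A: normal A G by fact
  show "(\<lambda>x. x [^] n) ` A \<subseteq> carrier G" by auto
  show "g \<otimes> h \<otimes> inv g \<in> (\<lambda>x. x [^] n) ` A" if h: "h \<in> (\<lambda>x. x [^] n) ` A" and g: "g \<in> carrier G" for h g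
  proof -
    obtain a where a: "a \<in> A" "h = a [^] n" using h by blast
    then have "g \<otimes> h \<otimes> inv g = (g \<otimes> a \<otimes> inv g) [^] n"
      using conj_pow[of a g n] g A.mem_carrier by simp
    then show ?thesis using A.inv_op_closed2[OF g a(1)] by blast
  qed
qed

end

context odd_p_group
begin

section \<open>Powerfully embedded subgroups\<close>

text \<open>
The hypothesis says that \<open>M\<close> is powerfully embedded in \<open>G\<close>; the conclusion is
\<open>[M\<^sup>p, G] \<le> [M, G]\<^sup>p\<close>. By \<open>normal_separation\<close> it suffices to work modulo a normal
subgroup \<open>C\<close> containing \<open>[M, G]\<^sup>p\<close> for which \<open>[M\<^sup>p, G]\<close> is central. There \<open>[m, [g, m]]\<close> is central
because \<open>[g, m] \<in> M\<^sup>p\<close>, and it has order dividing \<open>p\<close> because it lies in \<open>[M, G]\<close>.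
\<close>

lemma commutator_power_subgroup_le:
  assumes M: "M \<lhd> G"
    and le: "commutator_subgroup G M (carrier G) \<subseteq> power_subgroup G M p"
  shows "commutator_subgroup G (power_subgroup G M p) (carrier G) \<subseteq>
    power_subgroup G (commutator_subgroup G M (carrier G)) p"
    (is "?A \<subseteq> power_subgroup G ?D p")
proof (rule ccontr)
  assume not: "\<not> ?thesis"
  interpret M: normal M G by fact
  have nP: "power_subgroup G M p \<lhd> G" by (rule normal_power_subgroup[OF M])
  have nD: "?D \<lhd> G" by (rule normal_commutator_subgroup[OF M carrier_normal])
  have nA: "?A \<lhd> G" by (rule normal_commutator_subgroup[OF nP carrier_normal])
  obtain C where C: "C \<lhd> G" "power_subgroup G ?D p \<subseteq> C" "\<not> ?A \<subseteq> C"
    "\<forall>a\<in>?A. a [^] p \<in> C" "\<forall>a\<in>?A. \<forall>g\<in>carrier G. commutator G a g \<in> C"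
    by (rule normal_separation[OF nA normal_power_subgroup[OF nD] not])
  interpret C: normal C G by (rule C(1))
  have "commutator G g (m [^] p) \<in> C" if m: "m \<in> M" and g: "g \<in> carrier G" for m g
  proof (rule C.commutator_pow_mem[OF g M.mem_carrier[OF m] odd_p refl refl])
    note mc = M.mem_carrier[OF m]
    let ?c = "commutator G g m" and ?w = "commutator G m (commutator G g m)"
    have "commutator G m g \<in> ?D" by (rule commutator_mem[OF m g])
    then have c: "?c \<in> ?D"
      using inv_commutator[OF mc g] subgroup.m_inv_closed[OF normal_imp_subgroup[OF nD]] by metis
    then have cc: "?c \<in> carrier G" using g mc by simp
    have wD: "?w \<in> ?D" by (rule commutator_mem[OF m cc])
    have "commutator G ?c m \<in> ?A" using c le mc by (intro commutator_mem) auto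
    then have wA: "?w \<in> ?A"
      using inv_commutator[OF cc mc] subgroup.m_inv_closed[OF normal_imp_subgroup[OF nA]] by metis
    show "?c [^] p \<in> C" using c C(2) pow_mem by blast
    show "?w [^] p \<in> C" using wD C(2) pow_mem by blast
    show "commutator G ?w ?c \<in> C" "commutator G ?w m \<in> C" using wA C(5) cc mc by blast+
  qed
  then have "power_subgroup G M p \<subseteq> {u \<in> carrier G. commutator G g u \<in> C}" if "g \<in> carrier G" for g
    using that M.mem_carrier by (intro power_subgroup_leI C.subgroup_centralizer_mod) auto
  then have "commutator G u g \<in> C" if "u \<in> power_subgroup G M p" "g \<in> carrier G" for u g
    using that C.commutator_mem_sym by blast
  then have "?A \<subseteq> C" by (intro commutator_subgroup_leI C.subgroup_axioms)
  with C(3) show False by simp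
qed

text \<open>
For \<open>M\<close> powerfully embedded, \<open>M\<^sup>p\<close> is central modulo \<open>(M\<^sup>p)\<^sup>p\<close> by the previous lemma. So
modulo \<open>(M\<^sup>p)\<^sup>p\<close> the commutator \<open>[m, g] \<in> M\<^sup>p\<close> is central of order dividing \<open>p\<close>, and hence
\<open>[m, g\<^sup>p]\<close> is trivial.
\<close>

lemma commutator_power_carrier_le:
  assumes M: "M \<lhd> G"
    and le: "commutator_subgroup G M (carrier G) \<subseteq> power_subgroup G M p"
  shows "commutator_subgroup G M (power_subgroup G (carrier G) p) \<subseteq>
    power_subgroup G (power_subgroup G M p) p" (is "_ \<subseteq> ?B")
proof -
  interpret M: normal M G by fact
  have nP: "power_subgroup G M p \<lhd> G" by (rule normal_power_subgroup[OF M])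
  have "?B \<lhd> G" by (rule normal_power_subgroup[OF nP])
  then interpret B: normal ?B G .
  have MG: "commutator_subgroup G (power_subgroup G M p) (carrier G) \<subseteq> ?B"
    using commutator_power_subgroup_le[OF assms] power_subgroup_mono[OF le] by blast
  have "commutator G m (g [^] p) \<in> ?B" if m: "m \<in> M" and g: "g \<in> carrier G" for m g
  proof (rule B.commutator_pow_mem[OF M.mem_carrier[OF m] g odd_p refl refl])
    note mc = M.mem_carrier[OF m]
    let ?c = "commutator G m g" and ?w = "commutator G g (commutator G m g)"
    have c: "?c \<in> power_subgroup G M p" using commutator_mem[OF m g] le by blast
    have "commutator G ?c g \<in> ?B" using commutator_mem[OF c g] MG by blast
    then have w: "?w \<in> ?B" using B.commutator_mem_sym[of g ?c] g mc by simp
    show "?c [^] p \<in> ?B" by (rule pow_mem[OF c])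
    show "?w [^] p \<in> ?B" by (rule subgroup_nat_pow_closed[OF B.subgroup_axioms w])
    show "commutator G ?w ?c \<in> ?B" "commutator G ?w g \<in> ?B"
      using commutator_in_normal(2)[OF \<open>?B \<lhd> G\<close> _ w] g mc by auto
  qed
  then have "power_subgroup G (carrier G) p \<subseteq> {u \<in> carrier G. commutator G m u \<in> ?B}" if "m \<in> M" for m
    using that M.mem_carrier by (intro power_subgroup_leI B.subgroup_centralizer_mod) auto
  then show ?thesis by (intro commutator_subgroup_leI B.subgroup_axioms) blast
qed

text \<open>
In a powerful group generated by \<open>X\<close>, the subgroup \<open>G\<^sup>p\<close> is the normal closure of the \<open>p\<close>-th
powers of the elements of \<open>X\<close>. By \<open>normal_separation\<close> one may work modulo a normal subgroup \<open>C\<close> for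
which \<open>G\<^sup>p\<close> is central of exponent \<open>p\<close>; the same is then true of all commutators, so that \<open>x \<mapsto> x\<^sup>p\<close> is a homomorphism modulo \<open>C\<close>.
\<close>

lemma power_subgroup_le_of_generators:
  assumes pw: "commutator_subgroup G (carrier G) (carrier G) \<subseteq> power_subgroup G (carrier G) p"
    and X: "X \<subseteq> carrier G" "carrier G \<subseteq> generate G X"
    and Q: "Q \<lhd> G" "\<And>x. x \<in> X \<Longrightarrow> x [^] p \<in> Q"
  shows "power_subgroup G (carrier G) p \<subseteq> Q" (is "?A \<subseteq> Q")
proof (rule ccontr)
  assume not: "\<not> ?thesis"
  have nA: "?A \<lhd> G" by (rule normal_power_subgroup[OF carrier_normal])
  obtain C where C: "C \<lhd> G" "Q \<subseteq> C" "\<not> ?A \<subseteq> C" "\<forall>a\<in>?A. a [^] p \<in> C"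
    "\<forall>a\<in>?A. \<forall>g\<in>carrier G. commutator G a g \<in> C"
    by (rule normal_separation[OF nA Q(1) not])
  interpret C: normal C G by (rule C(1))
  have hom: "(x \<otimes> y) [^] p \<otimes> inv (x [^] p \<otimes> y [^] p) \<in> C" if "x \<in> carrier G" "y \<in> carrier G" for x y
  proof -
    have "commutator G y x \<in> ?A" using commutator_mem[OF that(2,1)] pw by blast
    then show ?thesis using C(4,5) that odd_p by (intro C.power_mult_mod) auto
  qed
  have "subgroup {x \<in> carrier G. x [^] p \<in> C} G"
  proof (rule subgroupI)
    have "\<one> \<in> {x \<in> carrier G. x [^] p \<in> C}" by simp
    then show "{x \<in> carrier G. x [^] p \<in> C} \<noteq> {}" by blast
    show "x \<otimes> y \<in> {x \<in> carrier G. x [^] p \<in> C}"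
      if "x \<in> {x \<in> carrier G. x [^] p \<in> C}" "y \<in> {x \<in> carrier G. x [^] p \<in> C}" for x y
    proof -
      have xy: "x \<in> carrier G" "y \<in> carrier G" "x [^] p \<in> C" "y [^] p \<in> C" using that by auto
      have "(x \<otimes> y) [^] p = ((x \<otimes> y) [^] p \<otimes> inv (x [^] p \<otimes> y [^] p)) \<otimes> (x [^] p \<otimes> y [^] p)"
        using xy by (simp add: m_assoc del: nat_pow_Suc)
      also have "\<dots> \<in> C" by (rule C.m_closed[OF hom[OF xy(1,2)] C.m_closed[OF xy(3,4)]])
      finally show ?thesis using xy by simp
    qed
  qed (auto simp: nat_pow_inv)
  then have "generate G X \<subseteq> {x \<in> carrier G. x [^] p \<in> C}"
    using X(1) Q(2) C(2) by (intro generate_subgroup_incl) auto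
  then have "?A \<subseteq> C" using X(2) by (intro power_subgroup_leI C.subgroup_axioms) auto
  with C(3) show False by simp
qed

lemma power_subgroup_less:
  assumes "M \<lhd> G" "M \<noteq> {\<one>}"
  shows "power_subgroup G M p \<subset> M"
proof -
  interpret M: normal M G by fact
  have "\<not> M \<subseteq> {\<one>}" using assms(2) M.one_closed by blast
  then obtain C where C: "C \<lhd> G" "{\<one>} \<subseteq> C" "\<not> M \<subseteq> C" "\<forall>a\<in>M. a [^] p \<in> C"
    "\<forall>a\<in>M. \<forall>g\<in>carrier G. commutator G a g \<in> C"
    by (rule normal_separation[OF assms(1) one_is_normal])
  then have "power_subgroup G M p \<subseteq> C"
    using normal_imp_subgroup[OF C(1)] by (intro power_subgroup_leI) auto
  with C(3) power_subgroup_le[OF M.subgroup_axioms] show ?thesis by blast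
qed

end

section \<open>The power series of a powerful group\<close>

primrec (in odd_p_group) agemo :: "nat \<Rightarrow> 'a set" where
  "agemo 0 = carrier G"
| "agemo (Suc i) = power_subgroup G (agemo i) p"

locale powerful_p_group = odd_p_group +
  assumes powerful: "commutator_subgroup G (carrier G) (carrier G) \<subseteq> power_subgroup G (carrier G) p"
begin

lemma normal_agemo: "agemo i \<lhd> G"
  by (induction i) (simp_all add: carrier_normal normal_power_subgroup)

lemma subgroup_agemo: "subgroup (agemo i) G"
  by (rule normal_imp_subgroup[OF normal_agemo])

lemma agemo_carrier: "x \<in> agemo i \<Longrightarrow> x \<in> carrier G"
  by (rule subgroup.mem_carrier[OF subgroup_agemo])

lemma agemo_Suc_le: "agemo (Suc i) \<subseteq> agemo i"
  by (simp add: power_subgroup_le[OF subgroup_agemo])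

lemma agemo_antimono: "i \<le> j \<Longrightarrow> agemo j \<subseteq> agemo i"
  by (rule lift_Suc_antimono_le[of agemo, OF agemo_Suc_le])

lemma commutator_agemo_carrier: "commutator_subgroup G (agemo i) (carrier G) \<subseteq> agemo (Suc i)"
proof (induction i)
  case (Suc i)
  have "commutator_subgroup G (agemo (Suc i)) (carrier G) \<subseteq>
      power_subgroup G (commutator_subgroup G (agemo i) (carrier G)) p"
    using commutator_power_subgroup_le[OF normal_agemo, of i] Suc by simp
  also have "\<dots> \<subseteq> agemo (Suc (Suc i))"
    using power_subgroup_mono[OF Suc, of p] by simp
  finally show ?case .
qed (use powerful in simp)

lemma commutator_agemo:
  assumes "x \<in> agemo i" "g \<in> carrier G"
  shows "commutator G x g \<in> agemo (Suc i)" "commutator G g x \<in> agemo (Suc i)"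
proof -
  show "commutator G x g \<in> agemo (Suc i)"
    using commutator_mem[OF assms] commutator_agemo_carrier by blast
  then show "commutator G g x \<in> agemo (Suc i)"
    using inv_commutator[OF agemo_carrier[OF assms(1)] assms(2)]
      subgroup.m_inv_closed[OF subgroup_agemo] by metis
qed

text \<open>
Commuting with \<open>G\<^sup>p\<close> gains two steps in the series where commuting with \<open>G\<close> gains one. The root of such
a commutator is therefore still one step deeper, which makes the descending induction in
\<open>powerful_conj_closure_agemo_1\<close> possible.
\<close>

lemma commutator_agemo_agemo_1:
  assumes "x \<in> agemo i" "y \<in> agemo 1"
  shows "commutator G x y \<in> agemo (Suc (Suc i))" "commutator G y x \<in> agemo (Suc (Suc i))"
proof -
  have "commutator_subgroup G (agemo i) (power_subgroup G (carrier G) p) \<subseteq> agemo (Suc (Suc i))"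
    using commutator_power_carrier_le[OF normal_agemo, of i] commutator_agemo_carrier[of i] by simp
  then show "commutator G x y \<in> agemo (Suc (Suc i))"
    using commutator_mem[OF assms] by auto
  then show "commutator G y x \<in> agemo (Suc (Suc i))"
    using inv_commutator[OF agemo_carrier[OF assms(1)] agemo_carrier[OF assms(2)]]
      subgroup.m_inv_closed[OF subgroup_agemo] by metis
qed

lemma agemo_trivial: "\<exists>n. agemo n = {\<one>}"
proof (rule ccontr)
  assume no: "\<not> ?thesis"
  have fin: "finite (agemo i)" for i
    using finite_carrier subgroup.subset[OF subgroup_agemo] by (rule rev_finite_subset)
  have less: "card (agemo (Suc i)) < card (agemo i)" for i
    using power_subgroup_less[OF normal_agemo] no psubset_card_mono[OF fin] by simp
  have "card (agemo i) + i \<le> card (agemo 0)" for i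
  proof (induction i)
    case (Suc i)
    then show ?case using less[of i] by linarith
  qed simp
  from this[of "Suc (card (agemo 0))"] show False by simp
qed

text \<open>
A factor \<open>y\<close> can be absorbed into the \<open>p\<close>-th power \<open>a\<^sup>p\<close>, up to an error one step further down the
series than \<open>y\<close>. Indeed \<open>y\<close> is a product of \<open>p\<close>-th powers of elements \<open>d\<close> of \<open>agemo (i + j)\<close>, and
\<open>(a d)\<^sup>p = a\<^sup>p d\<^sup>p\<close> modulo \<open>agemo (i + j + 2)\<close> because \<open>[d, a]\<close> lies in \<open>agemo (i + j + 1)\<close>, which is
central of exponent \<open>p\<close> modulo \<open>agemo (i + j + 2)\<close>.
\<close>

lemma agemo_absorb:
  assumes "a \<in> agemo i" "y \<in> agemo (Suc (i + j))"
  shows "\<exists>b\<in>agemo i. agemo (Suc (Suc (i + j))) #> (a [^] p \<otimes> y) = agemo (Suc (Suc (i + j))) #> (b [^] p)"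
proof -
  let ?C = "agemo (Suc (Suc (i + j)))"
  interpret C: normal ?C G by (rule normal_agemo)
  interpret q: group_hom G "G Mod ?C" "\<lambda>x. ?C #> x" by (rule C.group_hom_Mod)
  have le: "agemo (i + j) \<subseteq> agemo i" by (rule agemo_antimono) simp
  have step: "\<exists>b\<in>agemo i. ?C #> (a [^] p \<otimes> d [^] p) = ?C #> (b [^] p)"
    if a: "a \<in> agemo i" and d: "d \<in> agemo (i + j)" for a d
  proof -
    note ac = agemo_carrier[OF a] and dc = agemo_carrier[OF d]
    have w: "commutator G d a \<in> agemo (Suc (i + j))" by (rule commutator_agemo(1)[OF d ac])
    then have "commutator G d a [^] p \<in> ?C" using pow_mem[OF w] by simp
    then have "(a \<otimes> d) [^] p \<otimes> inv (a [^] p \<otimes> d [^] p) \<in> ?C"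
      using ac dc odd_p commutator_agemo(1)[OF w] by (intro C.power_mult_mod) auto
    then have "?C #> (a [^] p \<otimes> d [^] p) = ?C #> ((a \<otimes> d) [^] p)"
      using C.coset_eq_iff[of "(a \<otimes> d) [^] p" "a [^] p \<otimes> d [^] p"] ac dc by simp
    moreover have "a \<otimes> d \<in> agemo i"
      using a d le by (intro subgroup.m_closed[OF subgroup_agemo]) auto
    ultimately show ?thesis by blast
  qed
  have "y \<in> generate G ((\<lambda>x. x [^] p) ` agemo (i + j))"
    using assms(2) by (simp add: power_subgroup_def)
  then have "\<forall>a\<in>agemo i. \<exists>b\<in>agemo i. ?C #> (a [^] p \<otimes> y) = ?C #> (b [^] p)"
  proof (induction y)
    case one
    then show ?case using agemo_carrier by auto
  next
    case (incl y)
    then show ?case using step by auto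
  next
    case (inv y)
    then obtain d where d: "d \<in> agemo (i + j)" "y = d [^] p" by auto
    then have "inv y = inv d [^] p" using agemo_carrier[OF d(1)] by (simp add: nat_pow_inv)
    then show ?case using step subgroup.m_inv_closed[OF subgroup_agemo d(1)] by auto
  next
    case (eng y1 y2)
    show ?case
    proof
      fix a assume a: "a \<in> agemo i"
      have y: "y1 \<in> carrier G" "y2 \<in> carrier G"
        using eng(1,2) generate_in_carrier[of "(\<lambda>x. x [^] p) ` agemo (i + j)"] agemo_carrier by auto
      obtain b where b: "b \<in> agemo i" "?C #> (a [^] p \<otimes> y1) = ?C #> (b [^] p)"
        using eng(3) a by blast
      obtain c where c: "c \<in> agemo i" "?C #> (b [^] p \<otimes> y2) = ?C #> (c [^] p)"
        using eng(4) b(1) by blast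
      have "?C #> (a [^] p \<otimes> (y1 \<otimes> y2)) = (?C #> (a [^] p \<otimes> y1)) \<otimes>\<^bsub>G Mod ?C\<^esub> (?C #> y2)"
        using q.hom_mult[of "a [^] p \<otimes> y1" y2] y agemo_carrier[OF a] by (simp add: m_assoc)
      also have "\<dots> = ?C #> (c [^] p)"
        unfolding b(2) using q.hom_mult[of "b [^] p" y2] y agemo_carrier[OF b(1)] c(2) by simp
      finally show "\<exists>b\<in>agemo i. ?C #> (a [^] p \<otimes> (y1 \<otimes> y2)) = ?C #> (b [^] p)"
        using c(1) by blast
    qed
  qed
  then show ?thesis using assms(1) by blast
qed

text \<open>
Every element of \<open>agemo (i + 1)\<close>, by definition a product of \<open>p\<close>-th powers, is itself a \<open>p\<close>-th power
of an element of \<open>agemo i\<close>: successive approximation with the previous lemma ends because the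
series reaches the trivial group.
\<close>

lemma agemo_root:
  assumes x: "x \<in> agemo (Suc i)"
  obtains a where "a \<in> agemo i" "x = a [^] p"
proof -
  note xc = agemo_carrier[OF x]
  have approx: "\<exists>a\<in>agemo i. x \<otimes> inv (a [^] p) \<in> agemo (Suc (i + j))" for j
  proof (induction j)
    case 0
    have "x \<otimes> inv (\<one> [^] p) \<in> agemo (Suc (i + 0))" using x xc by simp
    then show ?case using subgroup.one_closed[OF subgroup_agemo] by blast
  next
    case (Suc j)
    then obtain a where a: "a \<in> agemo i" "x \<otimes> inv (a [^] p) \<in> agemo (Suc (i + j))" by blast
    note ac = agemo_carrier[OF a(1)]
    interpret M: normal "agemo (Suc (i + j))" G by (rule normal_agemo)
    interpret C: normal "agemo (Suc (Suc (i + j)))" G by (rule normal_agemo)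
    have "inv (a [^] p) \<otimes> (x \<otimes> inv (a [^] p)) \<otimes> a [^] p \<in> agemo (Suc (i + j))"
      using M.inv_op_closed1[OF _ a(2), of "a [^] p"] ac by simp
    then have "inv (a [^] p) \<otimes> x \<in> agemo (Suc (i + j))"
      using xc ac by (simp add: m_assoc)
    from agemo_absorb[OF a(1) this] obtain b where b: "b \<in> agemo i"
      "agemo (Suc (Suc (i + j))) #> (a [^] p \<otimes> (inv (a [^] p) \<otimes> x)) = agemo (Suc (Suc (i + j))) #> (b [^] p)"
      by blast
    moreover have "a [^] p \<otimes> (inv (a [^] p) \<otimes> x) = x"
      using xc ac by (simp flip: m_assoc)
    ultimately have "x \<otimes> inv (b [^] p) \<in> agemo (Suc (Suc (i + j)))"
      using C.coset_eq_iff[of x "b [^] p"] xc agemo_carrier[OF b(1)] by simp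
    then show ?case using b(1) by auto
  qed
  obtain n where n: "agemo n = {\<one>}" using agemo_trivial by blast
  obtain a where a: "a \<in> agemo i" "x \<otimes> inv (a [^] p) \<in> agemo (Suc (i + n))" using approx by blast
  then have "x \<otimes> inv (a [^] p) = \<one>" using n agemo_antimono[of n "Suc (i + n)"] by auto
  then have "x = a [^] p" using xc agemo_carrier[OF a(1)]
    by (metis inv_closed inv_equality inv_inv nat_pow_closed)
  with a(1) show ?thesis by (rule that)
qed

end

section \<open>Powerful conjugate closures\<close>

text \<open>
For a subgroup \<open>T\<close> containing \<open>a\<close> this is the normal closure of \<open>a\<close> in \<open>T\<close>. The acting subgroup is
a parameter because the argument compares closures under different subgroups.
\<close>

definition conj_closure :: "('a, 'b) monoid_scheme \<Rightarrow> 'a set \<Rightarrow> 'a \<Rightarrow> 'a set" where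
  "conj_closure G T a = generate G ((\<lambda>t. t \<otimes>\<^bsub>G\<^esub> a \<otimes>\<^bsub>G\<^esub> inv\<^bsub>G\<^esub> t) ` T)"

context group
begin

lemma conj_closure_leI:
  assumes "subgroup Q G" "\<And>t. t \<in> T \<Longrightarrow> t \<otimes> a \<otimes> inv t \<in> Q"
  shows "conj_closure G T a \<subseteq> Q"
  unfolding conj_closure_def by (rule generate_subgroup_incl) (use assms in auto)

lemma conj_mem_conj_closure: "t \<in> T \<Longrightarrow> t \<otimes> a \<otimes> inv t \<in> conj_closure G T a"
  unfolding conj_closure_def by (rule generate.incl) blast

lemma subgroup_conj_closure:
  "\<lbrakk>T \<subseteq> carrier G; a \<in> carrier G\<rbrakk> \<Longrightarrow> subgroup (conj_closure G T a) G"
  unfolding conj_closure_def by (rule generate_is_subgroup) auto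

lemma mem_conj_closure:
  assumes "subgroup T G" "a \<in> carrier G"
  shows "a \<in> conj_closure G T a"
  using conj_mem_conj_closure[OF subgroup.one_closed[OF assms(1)], of a] assms(2) by simp

lemma conj_closure_le:
  assumes "subgroup T G" "a \<in> T"
  shows "conj_closure G T a \<subseteq> T"
  using assms by (intro conj_closure_leI) (auto intro: subgroup.m_closed subgroup.m_inv_closed)

lemma commutator_mem_conj_closure:
  assumes "subgroup T G" "a \<in> carrier G" "t \<in> T"
  shows "commutator G t a \<in> conj_closure G T a"
proof -
  have P: "subgroup (conj_closure G T a) G"
    using assms by (intro subgroup_conj_closure subgroup.subset)
  show ?thesis unfolding commutator_def
    by (rule subgroup.m_closed[OF P conj_mem_conj_closure[OF assms(3)]
          subgroup.m_inv_closed[OF P mem_conj_closure[OF assms(1,2)]]])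
qed

lemma normal_conj_closure:
  assumes "a \<in> carrier G"
  shows "conj_closure G (carrier G) a \<lhd> G"
  unfolding conj_closure_def
proof (rule normal_generateI)
  show "(\<lambda>t. t \<otimes> a \<otimes> inv t) ` carrier G \<subseteq> carrier G" using assms by auto
  show "g \<otimes> h \<otimes> inv g \<in> (\<lambda>t. t \<otimes> a \<otimes> inv t) ` carrier G"
    if h: "h \<in> (\<lambda>t. t \<otimes> a \<otimes> inv t) ` carrier G" and g: "g \<in> carrier G" for h g
  proof -
    obtain t where t: "t \<in> carrier G" "h = t \<otimes> a \<otimes> inv t" using h by blast
    then have "g \<otimes> h \<otimes> inv g = (g \<otimes> t) \<otimes> a \<otimes> inv (g \<otimes> t)"
      using g assms by (simp add: inv_mult_group m_assoc)
    then show ?thesis using g t(1) by blast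
  qed
qed

lemma conj_closure_consistent:
  assumes "subgroup T G" "L \<subseteq> T" "a \<in> T"
  shows "conj_closure (G\<lparr>carrier := T\<rparr>) L a = conj_closure G L a"
proof -
  have "(\<lambda>t. t \<otimes> a \<otimes> inv\<^bsub>G\<lparr>carrier := T\<rparr>\<^esub> t) ` L = (\<lambda>t. t \<otimes> a \<otimes> inv t) ` L"
    using assms by (intro image_cong) auto
  moreover have "(\<lambda>t. t \<otimes> a \<otimes> inv t) ` L \<subseteq> T"
    using assms by (auto intro!: subgroup.m_closed[OF assms(1)] subgroup.m_inv_closed[OF assms(1)])
  ultimately show ?thesis
    using generate_consistent[OF _ assms(1)] by (simp add: conj_closure_def)
qed

text \<open>
Modulo \<open>B\<close> the element \<open>a\<close> commutes with \<open>[t, a]\<close>, hence with its conjugate \<open>[t, a] a = t a t\<^sup>-\<^sup>1\<close>; conjugating,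
any two conjugates of \<open>a\<close> commute, and they generate the closure.
\<close>

lemma commutator_conj_closure_le:
  assumes B: "B \<lhd> G" and a: "a \<in> carrier G"
    and aB: "\<And>t. t \<in> carrier G \<Longrightarrow> commutator G a (commutator G t a) \<in> B"
  shows "commutator_subgroup G (conj_closure G (carrier G) a) (conj_closure G (carrier G) a) \<subseteq> B"
    (is "commutator_subgroup G ?P ?P \<subseteq> B")
proof -
  interpret B: normal B G by fact
  have conj_a: "commutator G a (t \<otimes> a \<otimes> inv t) \<in> B" if t: "t \<in> carrier G" for t
  proof -
    have "t \<otimes> a \<otimes> inv t = commutator G t a \<otimes> a"
      using a t by (simp add: commutator_def m_assoc)
    moreover have "commutator G a a \<in> B" using a by (simp add: commutator_self)
    ultimately show ?thesis
      using subgroup.m_closed[OF B.subgroup_centralizer_mod[OF a], of "commutator G t a" a] aB[OF t] a t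
      by simp
  qed
  have conjs: "commutator G (s \<otimes> a \<otimes> inv s) (t \<otimes> a \<otimes> inv t) \<in> B"
    if s: "s \<in> carrier G" and t: "t \<in> carrier G" for s t
  proof -
    let ?u = "inv s \<otimes> t"
    have "s \<otimes> (?u \<otimes> a \<otimes> inv ?u) \<otimes> inv s = (s \<otimes> ?u) \<otimes> a \<otimes> inv (s \<otimes> ?u)"
      using s t a inv_mult_group[of s ?u] by (simp add: m_assoc)
    moreover have "s \<otimes> ?u = t" using s t by (simp flip: m_assoc)
    ultimately have "commutator G (s \<otimes> a \<otimes> inv s) (t \<otimes> a \<otimes> inv t) =
        s \<otimes> commutator G a (?u \<otimes> a \<otimes> inv ?u) \<otimes> inv s"
      using conj_commutator[of a "?u \<otimes> a \<otimes> inv ?u" s] s t a by simp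
    then show ?thesis using B.inv_op_closed2[OF s] conj_a[of ?u] s t by simp
  qed
  have gen: "?P \<subseteq> {u \<in> carrier G. commutator G x u \<in> B}"
    if "x \<in> carrier G" "\<And>t. t \<in> carrier G \<Longrightarrow> commutator G x (t \<otimes> a \<otimes> inv t) \<in> B" for x
    using that a by (intro conj_closure_leI B.subgroup_centralizer_mod) auto
  have "commutator G u (t \<otimes> a \<otimes> inv t) \<in> B" if "u \<in> ?P" "t \<in> carrier G" for u t
  proof -
    have "u \<in> carrier G" "commutator G (t \<otimes> a \<otimes> inv t) u \<in> B"
      using gen[of "t \<otimes> a \<otimes> inv t"] conjs that a by blast+
    then show ?thesis using B.commutator_mem_sym[of u "t \<otimes> a \<otimes> inv t"] that(2) a by simp
  qed
  moreover have "?P \<subseteq> carrier G" using a by (intro conj_closure_leI subgroup_self) auto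
  ultimately have "commutator G u v \<in> B" if "u \<in> ?P" "v \<in> ?P" for u v
    using gen[of u] that by blast
  then show ?thesis by (intro commutator_subgroup_leI B.subgroup_axioms)
qed

end

context odd_p_group
begin

abbreviation powerful_subset :: "'a set \<Rightarrow> bool" where
  "powerful_subset S \<equiv> commutator_subgroup G S S \<subseteq> power_subgroup G S p"

text \<open>
For a powerful subgroup \<open>S\<close>: \<open>[S, S, S] \<le> [S\<^sup>p, S] \<le> [S, S]\<^sup>p\<close>.
\<close>

lemma powerful_commutator_commutator:
  assumes S: "subgroup S G" and pw: "powerful_subset S"
  shows "commutator_subgroup G (commutator_subgroup G S S) S \<subseteq>
    power_subgroup G (commutator_subgroup G S S) p"
proof -
  interpret S: odd_p_group "G\<lparr>carrier := S\<rparr>" p by (rule odd_p_group_subgroup[OF S])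
  have le: "power_subgroup G S p \<subseteq> S" by (rule power_subgroup_le[OF S])
  have D: "commutator_subgroup G S S \<subseteq> S" using pw le by blast
  have "S \<lhd> G\<lparr>carrier := S\<rparr>" using S.carrier_normal by simp
  then have "commutator_subgroup G (power_subgroup G S p) S \<subseteq> power_subgroup G (commutator_subgroup G S S) p"
    using S.commutator_power_subgroup_le[of S] pw D le
    by (simp add: commutator_subgroup_consistent[OF S] power_subgroup_consistent[OF S])
  moreover have "commutator_subgroup G (commutator_subgroup G S S) S \<subseteq> commutator_subgroup G (power_subgroup G S p) S"
    using pw le subgroup.subset[OF S]
    by (intro commutator_subgroup_leI subgroup_commutator_subgroup commutator_mem) auto
  ultimately show ?thesis by blast
qed

lemma power_conj_closure_le:
  assumes L: "subgroup L G" and s: "s \<in> carrier G" and pw: "powerful_subset (conj_closure G L s)"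
    and R: "R \<lhd> G" and sR: "s [^] p \<in> R"
  shows "power_subgroup G (conj_closure G L s) p \<subseteq> R"
proof -
  let ?S = "conj_closure G L s" and ?X = "(\<lambda>t. t \<otimes> s \<otimes> inv t) ` L"
  have S: "subgroup ?S G" using s L by (intro subgroup_conj_closure subgroup.subset)
  interpret S: odd_p_group "G\<lparr>carrier := ?S\<rparr>" p by (rule odd_p_group_subgroup[OF S])
  have X: "?X \<subseteq> ?S" using conj_mem_conj_closure by blast
  have "R \<inter> ?S \<lhd> G\<lparr>carrier := ?S\<rparr>" using normal_Int_subgroup[OF S R] by simp
  moreover have "x [^] p \<in> R \<inter> ?S" if "x \<in> ?X" for x
  proof -
    obtain l where l: "l \<in> L" "x = l \<otimes> s \<otimes> inv l" using \<open>x \<in> ?X\<close> by blast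
    have lc: "l \<in> carrier G" using l(1) subgroup.subset[OF L] by blast
    have "x [^] p = l \<otimes> s [^] p \<otimes> inv l" using conj_pow[OF s lc] l(2) by simp
    then have "x [^] p \<in> R" using normal.inv_op_closed2[OF R lc sR] by simp
    then show ?thesis using subgroup_nat_pow_closed[OF S] X that by blast
  qed
  moreover have "generate (G\<lparr>carrier := ?S\<rparr>) ?X = ?S"
    using generate_consistent[OF X S] by (simp add: conj_closure_def)
  ultimately have "power_subgroup (G\<lparr>carrier := ?S\<rparr>) ?S p \<subseteq> R \<inter> ?S"
    using S.power_subgroup_le_of_generators[of ?X "R \<inter> ?S"] pw X
    by (simp add: commutator_subgroup_consistent[OF S] power_subgroup_consistent[OF S] nat_pow_consistent[symmetric])
  then show ?thesis by (simp add: power_subgroup_consistent[OF S])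
qed

text \<open>
The normal closure \<open>P\<close> of \<open>a\<close> inherits powerfulness from the closures \<open>S\<close> of the \<open>p\<close>-th roots \<open>s\<close> of
the commutators \<open>[t, a]\<close>. It suffices that \<open>[a, s\<^sup>p] \<in> P\<^sup>p\<close>. Now \<open>c = [a, s]\<close> and \<open>w = [s, c]\<close> lie in
\<open>P\<close>, so their \<open>p\<close>-th powers cause no trouble. They also lie in \<open>S\<close>, because \<open>a\<close> belongs to the acting
subgroup \<open>L\<close>; hence \<open>[w, c]\<close> and \<open>[w, s]\<close> lie in \<open>[S, S, S] \<le> (S\<^sup>p)\<^sup>p \<le> P\<^sup>p\<close>. The last inclusion
holds since \<open>S\<^sup>p\<close> is generated by the conjugates of \<open>s\<^sup>p = [t, a] \<in> P\<close>.
\<close>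

lemma powerful_normal_closure:
  assumes L: "subgroup L G" and a: "a \<in> L"
    and roots: "\<And>t. t \<in> carrier G \<Longrightarrow> \<exists>s\<in>L. commutator G t a = s [^] p \<and> powerful_subset (conj_closure G L s)"
  shows "powerful_subset (conj_closure G (carrier G) a)" (is "powerful_subset ?P")
proof (rule commutator_conj_closure_le)
  show ac: "a \<in> carrier G" using a subgroup.subset[OF L] by blast
  have nP: "?P \<lhd> G" by (rule normal_conj_closure[OF ac])
  then interpret P: normal ?P G .
  show nB: "power_subgroup G ?P p \<lhd> G" by (rule normal_power_subgroup[OF nP])
  then interpret B: normal "power_subgroup G ?P p" G .
  fix t assume t: "t \<in> carrier G"
  obtain s where s: "s \<in> L" and d: "commutator G t a = s [^] p" and pw: "powerful_subset (conj_closure G L s)"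
    using roots[OF t] by blast
  have sc: "s \<in> carrier G" using s subgroup.subset[OF L] by blast
  let ?S = "conj_closure G L s"
  have S: "subgroup ?S G" using L sc by (intro subgroup_conj_closure subgroup.subset)
  have sS: "s \<in> ?S" by (rule mem_conj_closure[OF L sc])
  define c w where "c = commutator G a s" and "w = commutator G s c"
  have aP: "a \<in> ?P" by (rule mem_conj_closure[OF subgroup_self ac])
  have cP: "c \<in> ?P" unfolding c_def by (rule commutator_in_normal(2)[OF nP sc aP])
  have wP: "w \<in> ?P" unfolding w_def by (rule commutator_in_normal(1)[OF nP sc cP])
  have cS: "c \<in> ?S" unfolding c_def by (rule commutator_mem_conj_closure[OF L sc a])
  have wS: "w \<in> commutator_subgroup G ?S ?S" unfolding w_def by (rule commutator_mem[OF sS cS])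
  have "s [^] p \<in> ?P" using commutator_mem_conj_closure[OF subgroup_self ac t] d by simp
  then have "power_subgroup G ?S p \<subseteq> ?P" by (rule power_conj_closure_le[OF L sc pw nP])
  then have "power_subgroup G (commutator_subgroup G ?S ?S) p \<subseteq> power_subgroup G ?P p"
    using pw by (intro power_subgroup_mono) blast
  then have SSS: "commutator_subgroup G (commutator_subgroup G ?S ?S) ?S \<subseteq> power_subgroup G ?P p"
    using powerful_commutator_commutator[OF S pw] by blast
  have "commutator G a (s [^] p) \<in> power_subgroup G ?P p"
  proof (rule B.commutator_pow_mem[OF ac sc odd_p c_def w_def])
    show "c [^] p \<in> power_subgroup G ?P p" "w [^] p \<in> power_subgroup G ?P p"
      using cP wP by (auto intro: pow_mem)
    show "commutator G w c \<in> power_subgroup G ?P p" "commutator G w s \<in> power_subgroup G ?P p"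
      using commutator_mem[OF wS cS] commutator_mem[OF wS sS] SSS by blast+
  qed
  then show "commutator G a (commutator G t a) \<in> power_subgroup G ?P p"
    unfolding d .
qed

lemma powerful_conj_closure:
  assumes T: "subgroup T G" and L: "subgroup L G" "L \<subseteq> T" and a: "a \<in> L"
    and roots: "\<And>t. t \<in> T \<Longrightarrow> \<exists>s\<in>L. commutator G t a = s [^] p \<and> powerful_subset (conj_closure G L s)"
  shows "powerful_subset (conj_closure G T a)"
proof -
  interpret T: odd_p_group "G\<lparr>carrier := T\<rparr>" p by (rule odd_p_group_subgroup[OF T])
  have cc: "conj_closure G L s \<subseteq> T" if "s \<in> L" for s
    using conj_closure_le[OF L(1) that] L(2) by blast
  have aT: "a \<in> T" using a L(2) by blast
  have P: "conj_closure G T a \<subseteq> T" by (rule conj_closure_le[OF T aT])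
  have "T.powerful_subset (conj_closure (G\<lparr>carrier := T\<rparr>) T a)"
  proof (rule T.powerful_normal_closure[of L a, simplified])
    show "subgroup L (G\<lparr>carrier := T\<rparr>)" by (rule subgroup_incl[OF L(1) T L(2)])
    fix t assume t: "t \<in> T"
    obtain s where s: "s \<in> L" "commutator G t a = s [^] p" "powerful_subset (conj_closure G L s)"
      using roots[OF t] by blast
    then have "s \<in> T" using L(2) by blast
    then have "commutator (G\<lparr>carrier := T\<rparr>) t a = s [^]\<^bsub>G\<lparr>carrier := T\<rparr>\<^esub> p"
      "T.powerful_subset (conj_closure (G\<lparr>carrier := T\<rparr>) L s)"
      using s cc[OF s(1)] commutator_consistent[OF T t aT]
      by (simp_all add: conj_closure_consistent[OF T L(2)] nat_pow_consistent[symmetric]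
          commutator_subgroup_consistent[OF T] power_subgroup_consistent[OF T])
    then show "\<exists>s\<in>L. commutator (G\<lparr>carrier := T\<rparr>) t a = s [^]\<^bsub>G\<lparr>carrier := T\<rparr>\<^esub> p \<and>
        T.powerful_subset (conj_closure (G\<lparr>carrier := T\<rparr>) L s)"
      using s(1) by blast
  qed (rule a)
  then show ?thesis
    using P by (simp add: conj_closure_consistent[OF T subset_refl aT]
        commutator_subgroup_consistent[OF T] power_subgroup_consistent[OF T])
qed

end

context powerful_p_group
begin

text \<open>
Descending induction along the series: for \<open>t \<in> G\<^sup>p\<close> the commutator \<open>[t, a]\<close> lies two steps deeper
than \<open>a\<close>, so its root lies one step deeper than \<open>a\<close>, and the induction hypothesis covers the root.
\<close>

lemma powerful_conj_closure_agemo_1: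
  assumes "a \<in> agemo (Suc m)"
  shows "powerful_subset (conj_closure G (agemo 1) a)"
proof -
  obtain n where n: "agemo n = {\<one>}" using agemo_trivial by blast
  have "\<forall>a\<in>agemo (Suc m). powerful_subset (conj_closure G (agemo 1) a)" if "n \<le> m + k" for k m
    using that
  proof (induction k arbitrary: m)
    case 0
    show ?case
    proof
      fix a assume "a \<in> agemo (Suc m)"
      then have "a = \<one>" using n agemo_antimono[of n "Suc m"] 0 by auto
      then have "conj_closure G (agemo 1) a \<subseteq> {\<one>}"
        using agemo_carrier[of _ 1] by (intro conj_closure_leI triv_subgroup) auto
      then have "commutator_subgroup G (conj_closure G (agemo 1) a) (conj_closure G (agemo 1) a) \<subseteq> {\<one>}"
        using commutator_in_subgroup[OF triv_subgroup]
        by (intro commutator_subgroup_leI triv_subgroup) blast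
      also have "{\<one>} \<subseteq> power_subgroup G (conj_closure G (agemo 1) a) p"
        unfolding power_subgroup_def by (simp add: generate.one)
      finally show "powerful_subset (conj_closure G (agemo 1) a)" .
    qed
  next
    case (Suc k)
    have IH: "\<forall>a\<in>agemo (Suc (Suc m)). powerful_subset (conj_closure G (agemo 1) a)"
      using Suc.IH[of "Suc m"] Suc.prems by simp
    show ?case
    proof
      fix a assume a: "a \<in> agemo (Suc m)"
      show "powerful_subset (conj_closure G (agemo 1) a)"
      proof (rule powerful_conj_closure[OF subgroup_agemo subgroup_agemo subset_refl])
        show "a \<in> agemo 1" using a agemo_antimono[of 1 "Suc m"] by auto
        fix t assume "t \<in> agemo 1"
        then have "commutator G t a \<in> agemo (Suc (Suc (Suc m)))"
          using commutator_agemo_agemo_1(2)[OF a] by blast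
        then obtain s where s: "s \<in> agemo (Suc (Suc m))" "commutator G t a = s [^] p"
          by (rule agemo_root)
        moreover have "s \<in> agemo 1" using s(1) agemo_antimono[of 1 "Suc (Suc m)"] by auto
        ultimately show "\<exists>s\<in>agemo 1. commutator G t a = s [^] p \<and> powerful_subset (conj_closure G (agemo 1) s)"
          using IH by blast
      qed
    qed
  qed
  from this[of m n] assms show ?thesis by simp
qed

text \<open>
Under a larger acting group \<open>T\<close> the root of \<open>[t, a]\<close> need not lie deeper than \<open>a\<close>, but it still lies
in \<open>G\<^sup>p\<close>, and it is enough that its closure under the smaller group \<open>G\<^sup>p\<close> is powerful.
\<close>

lemma powerful_conj_closure_of_agemo_1:
  assumes T: "subgroup T G" "agemo 1 \<subseteq> T" and a: "a \<in> agemo 1"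
  shows "powerful_subset (conj_closure G T a)"
proof (rule powerful_conj_closure[OF T(1) subgroup_agemo T(2) a])
  fix t assume "t \<in> T"
  then have "commutator G t a \<in> agemo (Suc 1)"
    using commutator_agemo(2)[OF a] subgroup.subset[OF T(1)] by blast
  then obtain s where "s \<in> agemo 1" "commutator G t a = s [^] p" by (rule agemo_root)
  then show "\<exists>s\<in>agemo 1. commutator G t a = s [^] p \<and> powerful_subset (conj_closure G (agemo 1) s)"
    using powerful_conj_closure_agemo_1[of _ 0] by auto
qed

text \<open>
The action is restricted to \<open>T = \<langle>a, G\<^sup>p\<rangle>\<close> so that \<open>[t, a]\<close> has a root in \<open>G\<^sup>p\<close>: modulo
\<open>agemo 2\<close> the subgroup \<open>G\<^sup>p\<close> is central, and \<open>T\<close> is generated by it and \<open>a\<close>, so \<open>T\<close> is abelian there.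
\<close>

lemma powerful_conj_closure_adjoin:
  assumes a: "a \<in> carrier G"
  defines "T \<equiv> generate G (insert a (agemo 1))"
  shows "powerful_subset (conj_closure G T a)"
proof -
  have gc: "insert a (agemo 1) \<subseteq> carrier G" using a agemo_carrier by blast
  have T: "subgroup T G" unfolding T_def by (rule generate_is_subgroup[OF gc])
  have aT: "a \<in> T" and KT: "agemo 1 \<subseteq> T" unfolding T_def by (auto intro: generate.incl)
  interpret K: normal "agemo (Suc 1)" G by (rule normal_agemo)
  have "T \<subseteq> {t \<in> carrier G. commutator G a t \<in> agemo (Suc 1)}"
    unfolding T_def
  proof (intro generate_subgroup_incl K.subgroup_centralizer_mod a)
    have "commutator G a a \<in> agemo (Suc 1)" unfolding commutator_self[OF a] by (rule K.one_closed)
    then show "insert a (agemo 1) \<subseteq> {t \<in> carrier G. commutator G a t \<in> agemo (Suc 1)}"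
      using a commutator_agemo(2)[of _ 1 a] agemo_carrier[of _ 1] by blast
  qed
  then have comm: "commutator G t a \<in> agemo (Suc 1)" if "t \<in> T" for t
    using that K.commutator_mem_sym[of a t] a by blast
  show ?thesis
  proof (rule powerful_conj_closure[OF T T subset_refl aT])
    fix t assume "t \<in> T"
    from comm[OF this] obtain s where "s \<in> agemo 1" "commutator G t a = s [^] p" by (rule agemo_root)
    then show "\<exists>s\<in>T. commutator G t a = s [^] p \<and> powerful_subset (conj_closure G T s)"
      using powerful_conj_closure_of_agemo_1[OF T KT] KT by blast
  qed
qed

section \<open>Normal subgroups inside the power subgroup\<close>

text \<open>
Write \<open>x \<in> N\<close> as \<open>a\<^sup>p\<close> with \<open>a\<close> one step higher in the series, and let \<open>P\<close> be the closure of \<open>a\<close>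
under \<open>T = \<langle>a, G\<^sup>p\<rangle>\<close>; put \<open>V = N \<inter> agemo (i + 2)\<close>. Since \<open>P\<close> is powerful, \<open>P\<^sup>p\<close> is generated by
conjugates of \<open>x\<close>, so \<open>[P, P] \<le> P\<^sup>p \<le> N\<close>; as \<open>[a, [t, a]]\<close> lies two steps deeper than \<open>a\<close>, \<open>[P, P] \<le> V\<close> and \<open>[P, P, P] \<le> [P, P]\<^sup>p \<le> V\<^sup>p\<close>. For \<open>h \<in> N\<close> the
commutators \<open>c = [h, a]\<close> and \<open>w = [a, c]\<close> lie both in \<open>V\<close> and in \<open>P\<close> (as \<open>N \<le> T\<close>), so
\<open>[h, a\<^sup>p] \<in> V\<^sup>p\<close>.
\<close>

lemma commutator_normal_Int_agemo:
  assumes N: "N \<lhd> G" and le: "N \<subseteq> agemo 1"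
  shows "commutator_subgroup G (N \<inter> agemo (Suc i)) N \<subseteq> power_subgroup G (N \<inter> agemo (Suc (Suc i))) p"
proof -
  let ?V = "N \<inter> agemo (Suc (Suc i))"
  interpret N: normal N G by fact
  have nV: "?V \<lhd> G" by (rule normal_subgroup_intersect[OF N normal_agemo])
  then interpret V: normal ?V G .
  have "power_subgroup G ?V p \<lhd> G" by (rule normal_power_subgroup[OF nV])
  then interpret B: normal "power_subgroup G ?V p" G .
  have main: "commutator G h x \<in> power_subgroup G ?V p" if x: "x \<in> N \<inter> agemo (Suc i)" and h: "h \<in> N" for x h
  proof -
    obtain a where a: "a \<in> agemo i" "x = a [^] p" using x agemo_root by blast
    have ac: "a \<in> carrier G" and hc: "h \<in> carrier G" using a(1) agemo_carrier h by auto
    define T where "T = generate G (insert a (agemo 1))"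
    have gc: "insert a (agemo 1) \<subseteq> carrier G" using ac agemo_carrier by blast
    have T: "subgroup T G" unfolding T_def by (rule generate_is_subgroup[OF gc])
    have aT: "a \<in> T" and hT: "h \<in> T" unfolding T_def using h le by (auto intro: generate.incl)
    let ?P = "conj_closure G T a"
    have P: "subgroup ?P G" using T ac by (intro subgroup_conj_closure subgroup.subset)
    have pw: "powerful_subset ?P" unfolding T_def by (rule powerful_conj_closure_adjoin[OF ac])
    have PN: "commutator_subgroup G ?P ?P \<subseteq> N"
      using power_conj_closure_le[OF T ac pw N] pw a(2) x by blast
    have PK: "commutator_subgroup G ?P ?P \<subseteq> agemo (Suc (Suc i))"
    proof -
      interpret T: group "G\<lparr>carrier := T\<rparr>" by (rule subgroup_imp_group[OF T])
      have PT: "?P \<subseteq> T" by (rule conj_closure_le[OF T aT])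
      have "commutator_subgroup (G\<lparr>carrier := T\<rparr>) (conj_closure (G\<lparr>carrier := T\<rparr>) T a) (conj_closure (G\<lparr>carrier := T\<rparr>) T a)
          \<subseteq> agemo (Suc (Suc i)) \<inter> T"
      proof (rule T.commutator_conj_closure_le[simplified])
        show "agemo (Suc (Suc i)) \<inter> T \<lhd> G\<lparr>carrier := T\<rparr>"
          by (rule normal_Int_subgroup[OF T normal_agemo])
        show "a \<in> T" by (rule aT)
        fix t assume t: "t \<in> T"
        then have tc: "t \<in> carrier G" using subgroup.subset[OF T] by blast
        have ta: "commutator G t a \<in> T" by (rule commutator_in_subgroup[OF T t aT])
        have "commutator G a (commutator G t a) \<in> agemo (Suc (Suc i)) \<inter> T"
          using commutator_agemo(2)[OF commutator_agemo(2)[OF a(1) tc] ac]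
            commutator_in_subgroup[OF T aT ta] by blast
        then show "commutator (G\<lparr>carrier := T\<rparr>) a (commutator (G\<lparr>carrier := T\<rparr>) t a) \<in> agemo (Suc (Suc i)) \<inter> T"
          using commutator_consistent[OF T t aT] commutator_consistent[OF T aT ta] by simp
      qed
      then show ?thesis
        using PT by (simp add: conj_closure_consistent[OF T subset_refl aT] commutator_subgroup_consistent[OF T])
    qed
    have PPP: "commutator_subgroup G (commutator_subgroup G ?P ?P) ?P \<subseteq> power_subgroup G ?V p"
      using powerful_commutator_commutator[OF P pw] power_subgroup_mono[of "commutator_subgroup G ?P ?P" ?V p] PN PK
      by blast
    define c w where "c = commutator G h a" and "w = commutator G a c"
    have aP: "a \<in> ?P" by (rule mem_conj_closure[OF T ac])
    have cP: "c \<in> ?P" unfolding c_def by (rule commutator_mem_conj_closure[OF T ac hT])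
    have wP: "w \<in> commutator_subgroup G ?P ?P" unfolding w_def by (rule commutator_mem[OF aP cP])
    have cV: "c \<in> ?V"
      using commutator_in_normal(2)[OF N ac h] commutator_agemo_agemo_1(2)[OF a(1)] h le
      unfolding c_def by blast
    have wV: "w \<in> ?V" unfolding w_def by (rule commutator_in_normal(1)[OF nV ac cV])
    show ?thesis unfolding a(2)
    proof (rule B.commutator_pow_mem[OF hc ac odd_p c_def w_def])
      show "c [^] p \<in> power_subgroup G ?V p" "w [^] p \<in> power_subgroup G ?V p"
        by (rule pow_mem[OF cV], rule pow_mem[OF wV])
      show "commutator G w c \<in> power_subgroup G ?V p" "commutator G w a \<in> power_subgroup G ?V p"
        using commutator_mem[OF wP cP] commutator_mem[OF wP aP] PPP by blast+
    qed
  qed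
  show ?thesis
  proof (rule commutator_subgroup_leI[OF B.subgroup_axioms])
    fix x h assume x: "x \<in> N \<inter> agemo (Suc i)" and h: "h \<in> N"
    then show "commutator G x h \<in> power_subgroup G ?V p"
      using main[OF x h] B.commutator_mem_sym[of h x] by auto
  qed
qed

lemma powerfully_nilpotent_normal:
  assumes N: "N \<lhd> G" and le: "N \<subseteq> agemo 1"
  shows "powerfully_nilpotent p (G\<lparr>carrier := N\<rparr>)"
proof -
  interpret N: normal N G by fact
  interpret NG: odd_p_group "G\<lparr>carrier := N\<rparr>" p by (rule odd_p_group_subgroup[OF N.subgroup_axioms])
  let ?N = "\<lambda>i. N \<inter> agemo i"
  note consistent = commutator_subgroup_consistent[OF N.subgroup_axioms]
    power_subgroup_consistent[OF N.subgroup_axioms]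
  have N1: "?N (Suc 0) = N" using le by auto
  have "commutator_subgroup G N N \<subseteq> power_subgroup G (?N (Suc (Suc 0))) p"
    using commutator_normal_Int_agemo[OF assms, of 0] unfolding N1 .
  also have "\<dots> \<subseteq> power_subgroup G N p" by (rule power_subgroup_mono) simp
  finally have pw: "powerful p (G\<lparr>carrier := N\<rparr>)"
    using NG.p_group by (simp add: powerful_def consistent)
  obtain n where n: "agemo n = {\<one>}" using agemo_trivial by blast
  \<comment> \<open>The chain has to ascend from \<open>{\<one>}\<close>, so the series is traversed backwards from index \<open>n + 1\<close>; it stops at index 1, where \<open>?N\<close> equals \<open>N\<close>.\<close>
  define K where "K = (\<lambda>i. ?N (Suc n - i))"
  have K0: "K 0 = {\<one>}"
    using agemo_antimono[of n "Suc n"] n subgroup.one_closed[OF subgroup_agemo, of "Suc n"] N.one_closed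
    unfolding K_def by auto
  have Kn: "K n = N" unfolding K_def using N1 by simp
  have sub: "subgroup (K i) (G\<lparr>carrier := N\<rparr>)" for i
    unfolding K_def by (intro subgroup_incl subgroups_Inter_pair N.subgroup_axioms subgroup_agemo) simp
  have step: "K (i - 1) \<subseteq> K i \<and> commutator_subgroup (G\<lparr>carrier := N\<rparr>) (K i) N \<subseteq> power_subgroup (G\<lparr>carrier := N\<rparr>) (K (i - 1)) p"
    if i: "i \<in> {1..n}" for i
  proof -
    obtain j where j: "Suc n - i = Suc j" "Suc n - (i - 1) = Suc (Suc j)"
      using i by (cases "n - i") (auto simp: Suc_diff_le)
    show ?thesis
      using agemo_Suc_le[of "Suc j"] commutator_normal_Int_agemo[OF assms, of j]
      unfolding K_def j by (auto simp: consistent)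
  qed
  show ?thesis
    unfolding powerfully_nilpotent_def using pw K0 Kn sub step
    by (intro conjI exI[of _ n] exI[of _ K]) auto
qed

end

theorem theorem12:
  fixes p :: nat and G (structure) and N :: "'a set"
  assumes "prime p" and "odd p"
    and "powerful p G"
    and "N \<lhd> G"
    and "N \<subseteq> power_subgroup G (carrier G) p"
  shows "powerfully_nilpotent p (G\<lparr>carrier := N\<rparr>)"
proof -
  interpret group G using assms(4) by (simp add: normal_def)
  interpret powerful_p_group G p
    using assms(1-3) by unfold_locales (auto simp: powerful_def)
  show ?thesis using powerfully_nilpotent_normal[OF assms(4)] assms(5) by simp
qed

end
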